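(* Let $p>1$ and $a,b\in I$ with $a<b$. Assume the $q_{ij}$ are continuously differentiable with respect to $x$ in $[a,b]\times\mathbb R^d$, let $\beta_i=b_i-\sum_{j=1}^dD_jq_{ij}$, and assume there is a constant $K_p'>0$ with $\frac{|\beta(t,x)|^2}{4(p-1)\eta(t,x)}-c(t,x)\le K_p'$ for $(t,x)\in[a,b]\times\mathbb R^d$. Then for all $a\le s\le t\le b$, $G(t,s)$ leaves $L^p(\mathbb R^d)$ invariant, i.e. for every $f\in L^p(\mathbb R^d)$ the function $(G(t,s)f)(x)=\int_{\mathbb R^d}g(t,s,x,y)f(y)dy$ (for $t>s$) belongs to $L^p(\mathbb R^d)$, and $\|G(t,s)f\|_{L^p(\mathbb R^d)}\le e^{K_p'(t-s)}\|f\|_{L^p(\mathbb R^d)}$.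
   Context: Let $d\ge1$, $\alpha\in(0,1)$, $I\subseteq\mathbb R$ either $\mathbb R$ or a right half-line. For $t\in I$, $(\mathcal A(t)\psi)(x)=\sum_{i,j}q_{ij}(t,x)D_{ij}\psi(x)+\sum_ib_i(t,x)D_i\psi(x)-c(t,x)\psi(x)$, with: $q_{ij},b_i,c\in C^{\alpha/2,\alpha}_{\rm loc}(I\times\mathbb R^d)$; $\inf c>-\infty$; $Q=(q_{ij})$ symmetric and there is $\eta:I\times\mathbb R^d\to\mathbb R$ with $\inf\eta>0$ and $\langle Q(t,x)\xi,\xi\rangle\ge\eta(t,x)|\xi|^2$ for all $\xi\in\mathbb R^d$; for every bounded interval $J\subset I$ there are positive $\phi_J\in C^2(\mathbb R^d)$ with $\phi_J\to+\infty$ at infinity and $\lambda_J$ with $\mathcal A(t)\phi_J\le\lambda_J\phi_J$ on $J\times\mathbb R^d$. $G(t,s)$ is the evolution operator on $C_b(\mathbb R^d)$: $G(t,s)f=u_f(t,\cdot)$ for $t>s$, $u_f$ the unique solution (bounded on strips, in $C([s,\infty)\times\mathbb R^d)\cap C^{1+\alpha/2,2+\alpha}_{\rm loc}((s,\infty)\times\mathbb R^d)$) of $D_tu=\mathcal A(t)u$, $u(s)=f$; $G(t,t)=\mathrm{id}$. Its Green function $g$ is positive with $(G(t,s)f)(x)=\int g(t,s,x,y)f(y)dy$ for $f\in C_b(\mathbb R^d)$. *)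

theory Defs
  imports "HOL-Analysis.Analysis"
begin

text \<open>Points of R^d are vectors of type real^'d (d = CARD('d) \<ge> 1).
  Coefficients: Q t x i j = q_ij(t,x), B t x i = b_i(t,x), c t x.\<close>

definition has_partial :: "(real^'d \<Rightarrow> real) \<Rightarrow> 'd \<Rightarrow> real^'d \<Rightarrow> real \<Rightarrow> bool" where
  "has_partial \<phi> i x D \<longleftrightarrow> ((\<lambda>h. \<phi> (x + h *\<^sub>R axis i 1)) has_real_derivative D) (at 0)"

definition holder_loc :: "real \<Rightarrow> (real \<times> (real^'d)) set \<Rightarrow> (real \<Rightarrow> real^'d \<Rightarrow> real) \<Rightarrow> bool" where
  "holder_loc \<alpha> S F \<longleftrightarrow>
     (\<forall>K. compact K \<and> K \<subseteq> S \<longrightarrow>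
        (\<exists>C. \<forall>t x s y. (t, x) \<in> K \<and> (s, y) \<in> K \<longrightarrow>
            \<bar>F t x - F s y\<bar> \<le> C * (\<bar>t - s\<bar> powr (\<alpha>/2) + dist x y powr \<alpha>)))"

definition Aop :: "(real \<Rightarrow> real^'d \<Rightarrow> 'd \<Rightarrow> 'd \<Rightarrow> real) \<Rightarrow> (real \<Rightarrow> real^'d \<Rightarrow> 'd \<Rightarrow> real)
     \<Rightarrow> (real \<Rightarrow> real^'d \<Rightarrow> real) \<Rightarrow> real \<Rightarrow> real^'d \<Rightarrow> real \<Rightarrow> ('d \<Rightarrow> real) \<Rightarrow> ('d \<Rightarrow> 'd \<Rightarrow> real) \<Rightarrow> real" where
  "Aop Q B c t x u Du D2u =
     (\<Sum>i\<in>UNIV. \<Sum>j\<in>UNIV. Q t x i j * D2u i j) + (\<Sum>i\<in>UNIV. B t x i * Du i) - c t x * u"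

definition C2_with :: "(real^'d \<Rightarrow> real) \<Rightarrow> ('d \<Rightarrow> real^'d \<Rightarrow> real) \<Rightarrow> ('d \<Rightarrow> 'd \<Rightarrow> real^'d \<Rightarrow> real) \<Rightarrow> bool" where
  "C2_with \<phi> D\<phi> D2\<phi> \<longleftrightarrow>
     (\<forall>i x. has_partial \<phi> i x (D\<phi> i x)) \<and>
     (\<forall>i j x. has_partial (D\<phi> j) i x (D2\<phi> i j x)) \<and>
     continuous_on UNIV \<phi> \<and> (\<forall>i. continuous_on UNIV (D\<phi> i)) \<and>
     (\<forall>i j. continuous_on UNIV (D2\<phi> i j))"

definition standing_assms ::
  "real \<Rightarrow> real set \<Rightarrow> (real \<Rightarrow> real^'d \<Rightarrow> 'd \<Rightarrow> 'd \<Rightarrow> real) \<Rightarrow> (real \<Rightarrow> real^'d \<Rightarrow> 'd \<Rightarrow> real)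
     \<Rightarrow> (real \<Rightarrow> real^'d \<Rightarrow> real) \<Rightarrow> (real \<Rightarrow> real^'d \<Rightarrow> real) \<Rightarrow> bool" where
  "standing_assms \<alpha> I Q B c \<eta> \<longleftrightarrow>
     0 < \<alpha> \<and> \<alpha> < 1 \<and>
     (I = UNIV \<or> (\<exists>t0. I = {t0..}) \<or> (\<exists>t0. I = {t0<..})) \<and>
     (\<forall>i j. holder_loc \<alpha> (I \<times> UNIV) (\<lambda>t x. Q t x i j)) \<and>
     (\<forall>i. holder_loc \<alpha> (I \<times> UNIV) (\<lambda>t x. B t x i)) \<and>
     holder_loc \<alpha> (I \<times> UNIV) c \<and>
     (\<exists>c0. \<forall>t\<in>I. \<forall>x. c0 \<le> c t x) \<and>
     (\<forall>t\<in>I. \<forall>x i j. Q t x i j = Q t x j i) \<and>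
     (\<exists>\<eta>0>0. \<forall>t\<in>I. \<forall>x. \<eta>0 \<le> \<eta> t x) \<and>
     (\<forall>t\<in>I. \<forall>x \<xi>. (\<Sum>i\<in>UNIV. \<Sum>j\<in>UNIV. Q t x i j * \<xi>$i * \<xi>$j) \<ge> \<eta> t x * (norm \<xi>)\<^sup>2) \<and>
     (\<forall>J. is_interval J \<and> bounded J \<and> J \<subseteq> I \<longrightarrow>
        (\<exists>\<phi> D\<phi> D2\<phi> lam. C2_with \<phi> D\<phi> D2\<phi> \<and> (\<forall>x. 0 < \<phi> x) \<and>
            filterlim \<phi> at_top at_infinity \<and>
            (\<forall>t\<in>J. \<forall>x. Aop Q B c t x (\<phi> x) (\<lambda>i. D\<phi> i x) (\<lambda>i j. D2\<phi> i j x) \<le> lam * \<phi> x)))"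

definition C12_holder_loc_with :: "real \<Rightarrow> (real \<times> (real^'d)) set \<Rightarrow> (real \<Rightarrow> real^'d \<Rightarrow> real)
     \<Rightarrow> (real \<Rightarrow> real^'d \<Rightarrow> real) \<Rightarrow> ('d \<Rightarrow> real \<Rightarrow> real^'d \<Rightarrow> real) \<Rightarrow> ('d \<Rightarrow> 'd \<Rightarrow> real \<Rightarrow> real^'d \<Rightarrow> real) \<Rightarrow> bool" where
  "C12_holder_loc_with \<alpha> S u Dt Du D2u \<longleftrightarrow>
     (\<forall>(t, x)\<in>S. ((\<lambda>\<tau>. u \<tau> x) has_real_derivative Dt t x) (at t)) \<and>
     (\<forall>(t, x)\<in>S. \<forall>i. has_partial (u t) i x (Du i t x)) \<and>
     (\<forall>(t, x)\<in>S. \<forall>i j. has_partial (Du j t) i x (D2u i j t x)) \<and>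
     holder_loc \<alpha> S u \<and> holder_loc \<alpha> S Dt \<and>
     (\<forall>i. holder_loc \<alpha> S (Du i)) \<and> (\<forall>i j. holder_loc \<alpha> S (D2u i j))"

definition Cb :: "(real^'d \<Rightarrow> real) set" where
  "Cb = {f. continuous_on UNIV f \<and> bounded (range f)}"

definition cauchy_sol :: "real \<Rightarrow> (real \<Rightarrow> real^'d \<Rightarrow> 'd \<Rightarrow> 'd \<Rightarrow> real) \<Rightarrow> (real \<Rightarrow> real^'d \<Rightarrow> 'd \<Rightarrow> real)
     \<Rightarrow> (real \<Rightarrow> real^'d \<Rightarrow> real) \<Rightarrow> real \<Rightarrow> (real^'d \<Rightarrow> real) \<Rightarrow> (real \<Rightarrow> real^'d \<Rightarrow> real) \<Rightarrow> bool" where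
  "cauchy_sol \<alpha> Q B c s f u \<longleftrightarrow>
     continuous_on ({s..} \<times> UNIV) (\<lambda>(t, x). u t x) \<and>
     (\<forall>T>s. bounded ((\<lambda>(t, x). u t x) ` ({s..T} \<times> UNIV))) \<and>
     (\<exists>Dt Du D2u. C12_holder_loc_with \<alpha> ({s<..} \<times> UNIV) u Dt Du D2u \<and>
        (\<forall>t>s. \<forall>x. Dt t x = Aop Q B c t x (u t x) (\<lambda>i. Du i t x) (\<lambda>i j. D2u i j t x))) \<and>
     (\<forall>x. u s x = f x)"

definition evol :: "real \<Rightarrow> (real \<Rightarrow> real^'d \<Rightarrow> 'd \<Rightarrow> 'd \<Rightarrow> real) \<Rightarrow> (real \<Rightarrow> real^'d \<Rightarrow> 'd \<Rightarrow> real)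
     \<Rightarrow> (real \<Rightarrow> real^'d \<Rightarrow> real) \<Rightarrow> real \<Rightarrow> real \<Rightarrow> (real^'d \<Rightarrow> real) \<Rightarrow> real^'d \<Rightarrow> real" where
  "evol \<alpha> Q B c t s f =
     (if t = s then f else (THE v. \<exists>u. cauchy_sol \<alpha> Q B c s f u \<and> v = u t))"

definition green_fun :: "real \<Rightarrow> real set \<Rightarrow> (real \<Rightarrow> real^'d \<Rightarrow> 'd \<Rightarrow> 'd \<Rightarrow> real) \<Rightarrow> (real \<Rightarrow> real^'d \<Rightarrow> 'd \<Rightarrow> real)
     \<Rightarrow> (real \<Rightarrow> real^'d \<Rightarrow> real) \<Rightarrow> (real \<Rightarrow> real \<Rightarrow> real^'d \<Rightarrow> real^'d \<Rightarrow> real) \<Rightarrow> bool" where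
  "green_fun \<alpha> I Q B c g \<longleftrightarrow>
     (\<forall>s\<in>I. \<forall>t>s. \<forall>x y. 0 < g t s x y) \<and>
     (\<forall>s\<in>I. \<forall>t>s. \<forall>f\<in>Cb. \<forall>x.
        integrable lebesgue (\<lambda>y. g t s x y * f y) \<and>
        evol \<alpha> Q B c t s f x = (LINT y|lebesgue. g t s x y * f y))"

definition green_apply :: "(real \<Rightarrow> real \<Rightarrow> real^'d \<Rightarrow> real^'d \<Rightarrow> real) \<Rightarrow> real \<Rightarrow> real \<Rightarrow> (real^'d \<Rightarrow> real) \<Rightarrow> real^'d \<Rightarrow> real" where
  "green_apply g t s f x = (if t = s then f x else LINT y|lebesgue. g t s x y * f y)"

definition in_Lp :: "real \<Rightarrow> (real^'d \<Rightarrow> real) \<Rightarrow> bool" where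
  "in_Lp p f \<longleftrightarrow> f \<in> borel_measurable lebesgue \<and> integrable lebesgue (\<lambda>x. \<bar>f x\<bar> powr p)"

definition Lp_norm :: "real \<Rightarrow> (real^'d \<Rightarrow> real) \<Rightarrow> real" where
  "Lp_norm p f = (LINT x|lebesgue. \<bar>f x\<bar> powr p) powr (1 / p)"

end

theory Submission
  imports Defs
begin

text \<open>
  Let \<open>\<phi>\<close> be a Lyapunov function with rate \<open>\<lambda> \<ge> 0\<close> and \<open>u\<close> a bounded solution. Then
  \<open>w = u - \<epsilon> exp (\<lambda> (t - s)) \<phi>\<close> satisfies \<open>D\<^sub>t w \<le> A(t) w\<close> and its positive part has compact support,
  so that \<open>\<integral> w\<^sub>+\<^sup>p\<close> can be differentiated and integrated by parts although the coefficients are unbounded.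
  Ellipticity and Young's inequality give \<open>d/dt \<integral> w\<^sub>+\<^sup>p \<le> p K \<integral> w\<^sub>+\<^sup>p\<close>, and \<open>\<epsilon> \<rightarrow> 0\<close> yields
  \<open>\<integral> u\<^sub>+(t)\<^sup>p \<le> exp (p K (t - s)) \<integral> u\<^sub>+(s)\<^sup>p\<close>. Applied to differences, this estimate also gives uniqueness for the
  Cauchy problem; solvability for nonnegative data is forced by the positivity of the Green function.
  The bound extends from \<open>C\<^sub>b\<close> to \<open>L\<^sup>p\<close> by approximating measurable functions almost everywhere by
  continuous ones.
\<close>

section \<open>A truncated power function\<close>

text \<open>The shape of K comes from completing a square. Put \<open>h = tpow'\<close> and let
  \<beta> be the drift left over when one derivative is moved off the second-order term. As w h'
  \<ge> (p - 1) h, the dissipation is at least h (p - 1) \<eta> |Dw|^2 / w, and Young's inequality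
  with exactly this weight leaves h w |\<beta>|^2 / (4 (p - 1) \<eta>). Together with the potential
  term this is at most K h w, and h w is nearly p times the p-th power of w: the rate is p K for the
  integral and K for the norm. Two obstacles shape the argument. No decay of u at infinity is known,
  so every integral is taken over a box that grows as \<epsilon> shrinks, and the truncation level
  \<delta> has to be chosen after the box. Moreover \<open>evol\<close> is a definite description,
  and g is known only through its positivity and its action on \<open>Cb\<close>. Measurability of
  the integrals in x is therefore first read off from the continuity of solutions and then carried
  through limits.\<close>

text \<open>A \<open>C\<^sup>2\<close> substitute for \<open>w\<^sub>+\<^sup>p\<close>, namely \<open>w\<^sup>p (1 - \<delta>/w)\<^sub>+\<^sup>3\<close>: for \<open>p < 2\<close> the power \<open>w\<^sub>+\<^sup>p\<close> itself is not
  smooth enough to integrate by parts. The cube is chosen so that \<open>w h' \<ge> (p - 1) h\<close> still holds for the derivative \<open>h\<close>.\<close>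

definition tpow :: "real \<Rightarrow> real \<Rightarrow> real \<Rightarrow> real" where
  "tpow p \<delta> w = max 0 (w - \<delta>) ^ 3 * w powr (p - 3)"

definition tpow' :: "real \<Rightarrow> real \<Rightarrow> real \<Rightarrow> real" where
  "tpow' p \<delta> w = 3 * max 0 (w - \<delta>) ^ 2 * w powr (p - 3)
     + (p - 3) * max 0 (w - \<delta>) ^ 3 * w powr (p - 4)"

definition tpow'' :: "real \<Rightarrow> real \<Rightarrow> real \<Rightarrow> real" where
  "tpow'' p \<delta> w = 6 * max 0 (w - \<delta>) * w powr (p - 3)
     + 6 * (p - 3) * max 0 (w - \<delta>) ^ 2 * w powr (p - 4)
     + (p - 3) * (p - 4) * max 0 (w - \<delta>) ^ 3 * w powr (p - 5)"

lemma tpow_eq_0 [simp]: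
  assumes "w \<le> \<delta>"
  shows "tpow p \<delta> w = 0" "tpow' p \<delta> w = 0" "tpow'' p \<delta> w = 0"
  using assms by (auto simp: tpow_def tpow'_def tpow''_def max_def)

text \<open>Powers of degree at least two smooth out the kink of the positive part. Degrees 3 and 2
  occur: the cube in \<open>tpow\<close> survives two differentiations and leaves the continuous
  factor \<open>max 0 (w - \<delta>)\<close>.\<close>

lemma DERIV_pos_part_power:
  fixes x :: real and n :: nat
  assumes "2 \<le> n"
  shows "((\<lambda>x. max 0 x ^ n) has_real_derivative n * max 0 x ^ (n - 1)) (at x)"
proof -
  consider "x < 0" | "x > 0" | "x = 0" by linarith
  then show ?thesis
  proof cases
    case 1
    have "((\<lambda>x. 0) has_real_derivative 0) (at x)" by simp
    then have "((\<lambda>x. max 0 x ^ n) has_real_derivative 0) (at x)"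
      by (rule has_field_derivative_transform_within_open[where S="{..<0}"]) (use 1 assms in \<open>auto simp: max_def\<close>)
    then show ?thesis using 1 assms by (simp add: max_def zero_power)
  next
    case 2
    have "((\<lambda>x. x ^ n) has_real_derivative n * x ^ (n - 1)) (at x)"
      by (auto intro!: derivative_eq_intros)
    then have "((\<lambda>x. max 0 x ^ n) has_real_derivative n * x ^ (n - 1)) (at x)"
      by (rule has_field_derivative_transform_within_open[where S="{0<..}"]) (use 2 in \<open>auto simp: max_def\<close>)
    then show ?thesis using 2 by (simp add: max_def)
  next
    case 3
    have "((\<lambda>h. max 0 h ^ n / h) \<longlongrightarrow> 0) (at (0::real))"
    proof (rule Lim_null_comparison)
      have "\<bar>max 0 h ^ n / h\<bar> \<le> \<bar>h\<bar> ^ (n - 1)" for h :: real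
        using assms by (cases n) (auto simp: max_def field_simps zero_power)
      then show "\<forall>\<^sub>F h in at 0. norm (max 0 h ^ n / h) \<le> \<bar>h\<bar> ^ (n - 1)"
        by (simp add: eventually_at_filter)
      show "((\<lambda>h. \<bar>h\<bar> ^ (n - 1)) \<longlongrightarrow> 0) (at (0::real))"
        by (rule tendsto_eq_intros refl)+ (use assms in auto)
    qed
    with 3 show ?thesis using assms by (simp add: has_field_derivative_iff zero_power)
  qed
qed

lemma tpow_deriv:
  assumes "0 < \<delta>"
  shows "(tpow p \<delta> has_real_derivative tpow' p \<delta> w) (at w)"
proof (cases "w < \<delta>")
  case True
  have "((\<lambda>x. 0) has_real_derivative 0) (at w)" by simp
  then have "(tpow p \<delta> has_real_derivative 0) (at w)"
    by (rule has_field_derivative_transform_within_open[where S="{..<\<delta>}"]) (use True in auto)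
  with True show ?thesis by simp
next
  case False
  \<comment> \<open>The boundary point \<open>w = \<delta>\<close> belongs to this case: the base of
    \<open>powr\<close> is positive there, so only the kink of \<open>max\<close> needs
    care.\<close>
  with assms have "w > 0" by simp
  have 1: "((\<lambda>w. max 0 (w - \<delta>) ^ 3) has_real_derivative 3 * max 0 (w - \<delta>) ^ 2) (at w)"
    using DERIV_shift[of "\<lambda>x. max 0 x ^ 3" _ w "- \<delta>"] DERIV_pos_part_power[of 3 "w - \<delta>"] by simp
  show ?thesis
    unfolding tpow_def[abs_def] tpow'_def
    by (rule derivative_eq_intros 1 refl | use \<open>w > 0\<close> in \<open>simp add: powr_diff field_simps\<close>)+
qed

lemma tpow'_deriv:
  assumes "0 < \<delta>"
  shows "(tpow' p \<delta> has_real_derivative tpow'' p \<delta> w) (at w)"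
proof (cases "w < \<delta>")
  case True
  have "((\<lambda>x. 0) has_real_derivative 0) (at w)" by simp
  then have "(tpow' p \<delta> has_real_derivative 0) (at w)"
    by (rule has_field_derivative_transform_within_open[where S="{..<\<delta>}"]) (use True in auto)
  with True show ?thesis by simp
next
  case False
  with assms have "w > 0" by simp
  have 1: "((\<lambda>w. max 0 (w - \<delta>) ^ 3) has_real_derivative 3 * max 0 (w - \<delta>) ^ 2) (at w)"
    using DERIV_shift[of "\<lambda>x. max 0 x ^ 3" _ w "- \<delta>"] DERIV_pos_part_power[of 3 "w - \<delta>"] by simp
  have 2: "((\<lambda>w. max 0 (w - \<delta>) ^ 2) has_real_derivative 2 * max 0 (w - \<delta>)) (at w)"
    using DERIV_shift[of "\<lambda>x. max 0 x ^ 2" _ w "- \<delta>"] DERIV_pos_part_power[of 2 "w - \<delta>"] by simp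
  show ?thesis
    unfolding tpow'_def[abs_def] tpow''_def
    by (rule derivative_eq_intros 1 2 refl | use \<open>w > 0\<close> in \<open>simp add: powr_diff field_simps\<close>)+
qed

lemma tpow_continuous:
  assumes "0 < \<delta>"
  shows "continuous_on UNIV (tpow p \<delta>)" "continuous_on UNIV (tpow' p \<delta>)" "continuous_on UNIV (tpow'' p \<delta>)"
proof -
  show "continuous_on UNIV (tpow p \<delta>)" "continuous_on UNIV (tpow' p \<delta>)"
    using tpow_deriv[OF assms] tpow'_deriv[OF assms] DERIV_isCont
    by (auto simp: continuous_on_eq_continuous_at intro!: DERIV_isCont)
  have "continuous_on {..\<delta>} (tpow'' p \<delta>)"
    by (rule continuous_on_eq[where f="\<lambda>_. 0"]) auto
  moreover have "continuous_on {\<delta>..} (tpow'' p \<delta>)"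
    unfolding tpow''_def[abs_def] using assms by (intro continuous_intros) auto
  ultimately have "continuous_on ({..\<delta>} \<union> {\<delta>..}) (tpow'' p \<delta>)"
    by (intro continuous_on_closed_Un) auto
  also have "{..\<delta>} \<union> {\<delta>..} = UNIV" by auto
  finally show "continuous_on UNIV (tpow'' p \<delta>)" .
qed

lemma tpow_nonneg: "0 \<le> tpow p \<delta> w"
  by (simp add: tpow_def)

lemma tpow_le:
  assumes "0 \<le> \<delta>"
  shows "tpow p \<delta> w \<le> max 0 w powr p"
proof (cases "w \<le> \<delta>")
  case False
  with assms have w: "w > 0" by simp
  have "tpow p \<delta> w \<le> w ^ 3 * w powr (p - 3)"
    unfolding tpow_def using False assms by (intro mult_right_mono power_mono) auto
  also have "\<dots> = w powr p" using w by (simp add: powr_diff)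
  finally show ?thesis using w by simp
qed (simp add: assms)

lemma tpow'_eq:
  assumes "0 < \<delta>" "\<delta> \<le> w"
  shows "tpow' p \<delta> w = w powr (p - 4) * (w - \<delta>)\<^sup>2 * (3 * w + (p - 3) * (w - \<delta>))"
  using assms by (simp add: tpow'_def powr_diff field_simps eval_nat_numeral)

text \<open>The bracket in \<open>tpow'_eq\<close> equals
  \<open>(p - 1) * (w - \<delta>) + w + 2 * \<delta>\<close>. The sign allows a differential
  inequality for w to be multiplied by \<open>tpow'\<close>.\<close>

lemma tpow'_nonneg:
  assumes "0 < \<delta>" "1 < p"
  shows "0 \<le> tpow' p \<delta> w"
proof (cases "w \<le> \<delta>")
  case False
  have "(p - 1) * (w - \<delta>) \<ge> 0" using assms False by simp
  then have "3 * w + (p - 3) * (w - \<delta>) \<ge> 0" using assms False by (simp add: algebra_simps)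
  then show ?thesis using assms False by (simp add: tpow'_eq)
qed simp

text \<open>For the pure power this is an equality; the truncation adds a nonnegative defect with
  the factor \<open>3 * \<delta>\<close>. It supplies the lower bound for the dissipation.\<close>

lemma tpow''_ge:
  assumes "0 < \<delta>" "1 < p"
  shows "(p - 1) * tpow' p \<delta> w \<le> w * tpow'' p \<delta> w"
proof (cases "w \<le> \<delta>")
  case False
  with assms have w: "w > 0" by simp
  have "w * tpow'' p \<delta> w - (p - 1) * tpow' p \<delta> w =
     w powr (p - 4) * (w - \<delta>) * (3 * \<delta>) * (2 * w + (p - 3) * (w - \<delta>))"
    using assms False w by (simp add: tpow'_def tpow''_def powr_diff field_simps eval_nat_numeral)
  moreover have "(p - 1) * (w - \<delta>) \<ge> 0" using assms False by simp
  then have "2 * w + (p - 3) * (w - \<delta>) \<ge> 0" using assms False by (simp add: algebra_simps)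
  ultimately have "w * tpow'' p \<delta> w - (p - 1) * tpow' p \<delta> w \<ge> 0"
    using assms False w by simp
  then show ?thesis by simp
qed simp

text \<open>Euler's identity for functions homogeneous of degree p, up to an error of order \<delta>
  due to the truncation. The error is uniform for w up to M, hence harmless after integration over a
  fixed box.\<close>

lemma tpow'_le:
  assumes "0 < \<delta>" "1 < p" "w \<le> M"
  shows "w * tpow' p \<delta> w \<le> p * tpow p \<delta> w + 3 * \<delta> * M powr (p - 1)"
proof (cases "w \<le> \<delta>")
  case False
  with assms have w: "w > 0" by simp
  have "w * tpow' p \<delta> w - p * tpow p \<delta> w = 3 * \<delta> * (w - \<delta>)\<^sup>2 * w powr (p - 3)"
    using assms False w by (simp add: tpow'_def tpow_def powr_diff field_simps eval_nat_numeral)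
  also have "\<dots> \<le> 3 * \<delta> * w\<^sup>2 * w powr (p - 3)"
    using assms False w by (intro mult_right_mono mult_left_mono power_mono) auto
  also have "\<dots> = 3 * \<delta> * w powr (p - 1)"
    using w by (simp add: powr_diff field_simps eval_nat_numeral)
  also have "\<dots> \<le> 3 * \<delta> * M powr (p - 1)"
    using assms w by (intro mult_left_mono powr_mono2) auto
  finally show ?thesis by simp
qed (use assms in simp)

lemma tpow_tendsto:
  assumes "(w \<longlongrightarrow> x) F" "(d \<longlongrightarrow> 0) F" "\<And>n. 0 < d n" "x \<le> 0 \<Longrightarrow> \<forall>\<^sub>F n in F. w n \<le> 0"
  shows "((\<lambda>n. tpow p (d n) (w n)) \<longlongrightarrow> max 0 x powr p) F"
proof (cases "x \<le> 0")
  case True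
  then have "\<forall>\<^sub>F n in F. tpow p (d n) (w n) = 0"
    by (rule eventually_mono[OF assms(4)]) (meson tpow_eq_0(1) order.trans less_imp_le assms(3))
  then show ?thesis using True by (simp add: tendsto_eventually)
next
  case False
  have "((\<lambda>n. tpow p (d n) (w n)) \<longlongrightarrow> max 0 (x - 0) ^ 3 * x powr (p - 3)) F"
    unfolding tpow_def by (intro tendsto_intros assms) (use False in auto)
  moreover have "max 0 (x - 0) ^ 3 * x powr (p - 3) = max 0 x powr p"
    using False by (simp add: powr_diff)
  ultimately show ?thesis by simp
qed

section \<open>The energy inequality for compactly supported subsolutions\<close>

lemma has_partial_at:
  assumes "\<And>x. has_partial F i x (F' x)"
  shows "((\<lambda>h. F (x + h *\<^sub>R axis i 1)) has_real_derivative F' (x + h *\<^sub>R axis i 1)) (at h)"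
proof -
  have "((\<lambda>k. F (x + h *\<^sub>R axis i 1 + k *\<^sub>R axis i 1)) has_real_derivative F' (x + h *\<^sub>R axis i 1)) (at 0)"
    using assms unfolding has_partial_def by blast
  then have "((\<lambda>k. F (x + (k + h) *\<^sub>R axis i 1)) has_real_derivative F' (x + h *\<^sub>R axis i 1)) (at 0)"
    by (simp add: algebra_simps)
  then show ?thesis
    using DERIV_shift[of "\<lambda>k. F (x + k *\<^sub>R axis i 1)" _ 0 h] by simp
qed

text \<open>Differentiation under the integral is done with the gauge integral over a box,
  translation invariance with the Lebesgue integral over the whole space; this links the
  two.\<close>

lemma integral_cbox_eq_lborel:
  fixes F :: "'a::euclidean_space \<Rightarrow> real"
  assumes "continuous_on UNIV F" "\<And>x. x \<notin> cbox l r \<Longrightarrow> F x = 0"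
  shows "integral (cbox l r) F = integral\<^sup>L lborel F" "integrable lborel F"
proof -
  have 1: "integrable lborel (\<lambda>x. indicator (cbox l r) x *\<^sub>R F x)"
    using borel_integrable_compact[OF compact_cbox continuous_on_subset[OF assms(1)], of l r] by simp
  have 2: "(\<lambda>x. indicator (cbox l r) x *\<^sub>R F x) = F"
    using assms(2) by (auto simp: fun_eq_iff indicator_def)
  show *: "integrable lborel F" using 1 2 by simp
  have "integral UNIV F = integral\<^sup>L lborel F" using * by (rule integral_lborel)
  moreover have "(\<lambda>x. if x \<in> cbox l r then F x else 0) = F"
    using assms(2) by (auto simp: fun_eq_iff)
  then have "integral UNIV F = integral (cbox l r) F"
    using integral_restrict_UNIV[of "cbox l r" F] by simp
  ultimately show "integral (cbox l r) F = integral\<^sup>L lborel F" by simp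
qed

text \<open>By translation invariance \<open>\<integral> F (x + h e\<^sub>i) dx\<close> does not depend on \<open>h\<close>; its derivative at \<open>h = 0\<close> is the integral in question.\<close>

lemma integral_partial_eq_0:
  fixes F F' :: "real^'d \<Rightarrow> real"
  assumes part: "\<And>x. has_partial F i x (F' x)" and contF: "continuous_on UNIV F"
    and contF': "continuous_on UNIV F'" and supp: "\<And>x. norm x > R \<Longrightarrow> F x = 0" "\<And>x. norm x > R \<Longrightarrow> F' x = 0"
    and box: "\<And>x. norm x \<le> R \<Longrightarrow> x \<in> cbox l r"
  shows "integral (cbox l r) F' = 0"
proof -
  let ?e = "axis i 1 :: real^'d"
  \<comment> \<open>The margin 1 keeps the support of every translate by \<open>h\<close> with |h| <
    1 inside one fixed box.\<close>
  obtain m where m: "cball 0 (R + 1) \<subseteq> cbox (- m) (m :: real^'d)"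
    using bounded_subset_cbox_symmetric[of "cball 0 (R + 1)"] by auto
  have eq: "integral (cbox (- m) m) (\<lambda>x. F (x + h *\<^sub>R ?e)) = integral\<^sup>L lborel F" if "h \<in> {-1<..<1}" for h
  proof -
    have "integral (cbox (- m) m) (\<lambda>x. F (x + h *\<^sub>R ?e)) = integral\<^sup>L lborel (\<lambda>x. F (x + h *\<^sub>R ?e))"
    proof (rule integral_cbox_eq_lborel)
      show "continuous_on UNIV (\<lambda>x. F (x + h *\<^sub>R ?e))"
        by (rule continuous_on_compose2[OF contF]) (auto intro!: continuous_intros)
      fix x assume "x \<notin> cbox (- m) m"
      then have "x \<notin> cball 0 (R + 1)" using m by blast
      then have "norm x > R + 1" by simp
      moreover have "norm x \<le> norm (x + h *\<^sub>R ?e) + norm (h *\<^sub>R ?e)" using norm_triangle_ineq4[of "x + h *\<^sub>R ?e" "h *\<^sub>R ?e"] by simp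
      moreover have "norm (h *\<^sub>R ?e) \<le> 1" using that by (simp add: norm_axis_1 abs_le_iff)
      ultimately show "F (x + h *\<^sub>R ?e) = 0" by (intro supp) linarith
    qed
    also have "\<dots> = integral\<^sup>L (distr lborel borel ((+) (h *\<^sub>R ?e))) F"
      by (subst integral_distr) (use contF in \<open>simp_all add: add.commute borel_measurable_continuous_onI\<close>)
    finally show ?thesis by (simp add: lborel_distr_plus)
  qed
  have "((\<lambda>h. integral (cbox (- m) m) (\<lambda>x. F (x + h *\<^sub>R ?e))) has_field_derivative
      integral (cbox (- m) m) (\<lambda>x. F' (x + 0 *\<^sub>R ?e))) (at 0 within {-1<..<1})"
  proof (rule leibniz_rule_field_derivative)
    fix h x show "((\<lambda>h. F (x + h *\<^sub>R ?e)) has_field_derivative F' (x + h *\<^sub>R ?e)) (at h within {-1<..<1})"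
      by (rule has_field_derivative_at_within[OF has_partial_at[OF part]])
  next
    fix h :: real show "(\<lambda>x. F (x + h *\<^sub>R ?e)) integrable_on cbox (- m) m"
      by (rule integrable_continuous, rule continuous_on_compose2[OF contF]) (auto intro!: continuous_intros)
  next
    show "continuous_on ({-1<..<1} \<times> cbox (- m) m) (\<lambda>(h, x). F' (x + h *\<^sub>R ?e))"
      unfolding split_beta by (rule continuous_on_compose2[OF contF']) (auto intro!: continuous_intros)
  qed auto
  moreover have "((\<lambda>h. integral (cbox (- m) m) (\<lambda>x. F (x + h *\<^sub>R ?e))) has_field_derivative 0) (at 0 within {-1<..<1})"
    by (rule has_field_derivative_transform_within[of "\<lambda>_. integral\<^sup>L lborel F" _ _ _ 1]) (auto simp: eq)
  ultimately have "integral (cbox (- m) m) F' = 0"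
    using at_within_open[of 0 "{-1<..<1::real}"] DERIV_unique by fastforce
  moreover have "integral (cbox (- m) m) F' = integral\<^sup>L lborel F'"
  proof (rule integral_cbox_eq_lborel[OF contF'])
    fix x assume "x \<notin> cbox (- m) m"
    then have "x \<notin> cball 0 (R + 1)" using m by blast
    then show "F' x = 0" by (intro supp(2)) simp
  qed
  moreover have "integral (cbox l r) F' = integral\<^sup>L lborel F'"
    by (rule integral_cbox_eq_lborel[OF contF'], rule supp(2)) (use box in \<open>fastforce simp: not_le\<close>)
  ultimately show ?thesis by simp
qed

text \<open>Integration by parts in pointwise form. Here \<open>z\<close> and \<open>z2\<close> are
  gradient and Hessian of w, \<open>dq k i j\<close> is the k-th partial derivative of q_ij, and the
  sum on the right is the divergence of the flux h(w) Q Dw written out, so that only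
  \<open>K * (h * w)\<close> survives integration.\<close>

lemma energy_pointwise:
  fixes z :: "'d::finite \<Rightarrow> real"
  assumes p: "1 < p" and \<eta>: "0 < \<eta>" and h: "0 \<le> h" "(p - 1) * h \<le> w * h'" and w: "w \<le> 0 \<Longrightarrow> h = 0 \<and> h' = 0"
    and ell: "\<eta> * (\<Sum>i\<in>UNIV. (z i)\<^sup>2) \<le> (\<Sum>i\<in>UNIV. \<Sum>j\<in>UNIV. q i j * z i * z j)"
    and sym: "\<And>i j. q i j = q j i"
    and Kb: "(\<Sum>i\<in>UNIV. (b i - (\<Sum>j\<in>UNIV. dq j i j))\<^sup>2) / (4 * (p - 1) * \<eta>) - c \<le> K"
  shows "h * ((\<Sum>i\<in>UNIV. \<Sum>j\<in>UNIV. q i j * z2 i j) + (\<Sum>i\<in>UNIV. b i * z i) - c * w)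
    \<le> (\<Sum>i\<in>UNIV. h' * z i * (\<Sum>j\<in>UNIV. q j i * z j) + h * (\<Sum>j\<in>UNIV. dq i j i * z j + q j i * z2 i j)) + K * (h * w)"
proof (cases "w \<le> 0")
  case True
  with w show ?thesis by simp
next
  case False
  then have w0: "w > 0" by simp
  define \<beta> where "\<beta> i = b i - (\<Sum>j\<in>UNIV. dq j i j)" for i
  \<comment> \<open>The multiple of |z|^2 that ellipticity together with h' \<ge> (p - 1) h / w can
    absorb. Used as the weight in Young's inequality it makes |\<beta>|^2 / (4 A) equal to w times
    the quotient in \<open>Kb\<close>.\<close>
  define A where "A = (p - 1) * \<eta> / w"
  have A: "A > 0" using p \<eta> w0 by (simp add: A_def)
  have h': "(p - 1) * h / w \<le> h'" using h(2) w0 by (simp add: field_simps)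
  have Z: "0 \<le> (\<Sum>i\<in>UNIV. (z i)\<^sup>2)" by (simp add: sum_nonneg)
  have 1: "h * A * (\<Sum>i\<in>UNIV. (z i)\<^sup>2) \<le> h' * (\<Sum>i\<in>UNIV. \<Sum>j\<in>UNIV. q i j * z i * z j)"
  proof -
    have "h * A * (\<Sum>i\<in>UNIV. (z i)\<^sup>2) = (p - 1) * h / w * (\<eta> * (\<Sum>i\<in>UNIV. (z i)\<^sup>2))" by (simp add: A_def)
    also have "\<dots> \<le> h' * (\<eta> * (\<Sum>i\<in>UNIV. (z i)\<^sup>2))" using h' Z \<eta> by (intro mult_right_mono) auto
    also have "\<dots> \<le> h' * (\<Sum>i\<in>UNIV. \<Sum>j\<in>UNIV. q i j * z i * z j)"
    proof (rule mult_left_mono[OF ell])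
      have "0 \<le> (p - 1) * h / w" using p h w0 by simp
      then show "0 \<le> h'" using h' by linarith
    qed
    finally show ?thesis .
  qed
  have young: "\<beta> i * z i \<le> A * (z i)\<^sup>2 + (\<beta> i)\<^sup>2 / (4 * A)" for i
  proof -
    have "0 \<le> (2 * A * z i - \<beta> i)\<^sup>2 / (4 * A)" using A by simp
    also have "\<dots> = A * (z i)\<^sup>2 + (\<beta> i)\<^sup>2 / (4 * A) - \<beta> i * z i" using A by (simp add: field_simps power2_eq_square)
    finally show ?thesis by simp
  qed
  have "(\<Sum>i\<in>UNIV. \<beta> i * z i) \<le> (\<Sum>i\<in>UNIV. A * (z i)\<^sup>2 + (\<beta> i)\<^sup>2 / (4 * A))" by (rule sum_mono[OF young])
  also have "\<dots> = A * (\<Sum>i\<in>UNIV. (z i)\<^sup>2) + (\<Sum>i\<in>UNIV. (\<beta> i)\<^sup>2) / (4 * A)"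
    by (simp add: sum.distrib sum_distrib_left sum_divide_distrib)
  also have "(\<Sum>i\<in>UNIV. (\<beta> i)\<^sup>2) / (4 * A) = w * ((\<Sum>i\<in>UNIV. (\<beta> i)\<^sup>2) / (4 * (p - 1) * \<eta>))"
    using w0 by (simp add: A_def field_simps)
  also have "\<dots> \<le> w * (K + c)" using Kb w0 by (intro mult_left_mono) (auto simp: \<beta>_def)
  finally have "h * (\<Sum>i\<in>UNIV. \<beta> i * z i) \<le> h * (A * (\<Sum>i\<in>UNIV. (z i)\<^sup>2) + w * (K + c))"
    using h(1) by (intro mult_left_mono) auto
  with 1 have 2: "h * (\<Sum>i\<in>UNIV. \<beta> i * z i) - c * h * w \<le> h' * (\<Sum>i\<in>UNIV. \<Sum>j\<in>UNIV. q i j * z i * z j) + K * (h * w)"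
    by (simp add: algebra_simps)
  have 3: "(\<Sum>i\<in>UNIV. \<Sum>j\<in>UNIV. dq i j i * z j) = (\<Sum>i\<in>UNIV. (\<Sum>j\<in>UNIV. dq j i j) * z i)"
    by (subst sum.swap) (simp add: sum_distrib_right)
  have 4: "(\<Sum>i\<in>UNIV. \<beta> i * z i) = (\<Sum>i\<in>UNIV. b i * z i) - (\<Sum>i\<in>UNIV. \<Sum>j\<in>UNIV. dq i j i * z j)"
    unfolding 3 \<beta>_def by (simp add: sum_subtractf left_diff_distrib)
  have 5: "(\<Sum>i\<in>UNIV. h' * z i * (\<Sum>j\<in>UNIV. q j i * z j) + h * (\<Sum>j\<in>UNIV. dq i j i * z j + q j i * z2 i j))
    = h' * (\<Sum>i\<in>UNIV. \<Sum>j\<in>UNIV. q i j * z i * z j) + h * (\<Sum>i\<in>UNIV. \<Sum>j\<in>UNIV. dq i j i * z j)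
     + h * (\<Sum>i\<in>UNIV. \<Sum>j\<in>UNIV. q i j * z2 i j)"
  proof -
    have "(\<Sum>j\<in>UNIV. q j i * z j) = (\<Sum>j\<in>UNIV. q i j * z j)"
      "(\<Sum>j\<in>UNIV. dq i j i * z j + q j i * z2 i j) = (\<Sum>j\<in>UNIV. dq i j i * z j) + (\<Sum>j\<in>UNIV. q i j * z2 i j)" for i
      unfolding sum.distrib[symmetric] by (intro sum.cong refl arg_cong2[where f="(*)"] arg_cong2[where f="(+)"] sym)+
    then show ?thesis
      by (simp add: sum.distrib sum_distrib_left distrib_left mult_ac)
  qed
  show ?thesis unfolding 5 using 2 unfolding 4 by (simp add: algebra_simps)
qed

section \<open>Growth of the truncated energy on a box\<close>

lemma has_partial_mult:
  assumes "has_partial f i x a" "has_partial g i x b"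
  shows "has_partial (\<lambda>x. f x * g x) i x (a * g x + f x * b)"
  using DERIV_mult[OF assms[unfolded has_partial_def]] by (simp add: has_partial_def mult.commute)

lemma has_partial_sum:
  assumes "\<And>j. j \<in> J \<Longrightarrow> has_partial (f j) i x (a j)"
  shows "has_partial (\<lambda>x. \<Sum>j\<in>J. f j x) i x (\<Sum>j\<in>J. a j)"
  using assms unfolding has_partial_def by (rule DERIV_sum)

lemma has_partial_compose:
  assumes "has_partial f i x a" "(H has_real_derivative b) (at (f x))"
  shows "has_partial (\<lambda>x. H (f x)) i x (b * a)"
  using DERIV_chain2[of H b "\<lambda>h. f (x + h *\<^sub>R axis i 1)" 0 a] assms unfolding has_partial_def by simp

lemma continuous_on_slice:
  assumes "continuous_on (A \<times> B) (\<lambda>(t, x). F t x)" "t \<in> A"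
  shows "continuous_on B (F t)"
proof -
  have "continuous_on B (\<lambda>x. case (t, x) of (t, x) \<Rightarrow> F t x)"
    by (rule continuous_on_compose2[OF assms(1)]) (use assms(2) in \<open>auto intro!: continuous_intros\<close>)
  then show ?thesis by simp
qed

text \<open>The conditions concern the open time interval, where the equation is available, and
  continuity in x at each fixed time; the endpoints enter only through the continuity of the
  solution.\<close>

locale dissipative_coefficients =
  fixes p K s T :: real
    and Q :: "real \<Rightarrow> real^'d \<Rightarrow> 'd \<Rightarrow> 'd \<Rightarrow> real"
    and B :: "real \<Rightarrow> real^'d \<Rightarrow> 'd \<Rightarrow> real"
    and c \<eta> :: "real \<Rightarrow> real^'d \<Rightarrow> real"
    and DQ :: "'d \<Rightarrow> 'd \<Rightarrow> 'd \<Rightarrow> real \<Rightarrow> real^'d \<Rightarrow> real"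
  assumes p: "1 < p" and K: "0 < K" and sT: "s < T"
    and Q_sym: "\<And>t x i j. t \<in> {s<..<T} \<Longrightarrow> Q t x i j = Q t x j i"
    and Q_cont: "\<And>t i j. t \<in> {s<..<T} \<Longrightarrow> continuous_on UNIV (\<lambda>x. Q t x i j)"
    and DQ: "\<And>t x i j k. t \<in> {s<..<T} \<Longrightarrow> has_partial (\<lambda>y. Q t y i j) k x (DQ k i j t x)"
    and DQ_cont: "\<And>t i j k. t \<in> {s<..<T} \<Longrightarrow> continuous_on UNIV (DQ k i j t)"
    and \<eta>: "\<And>t x. t \<in> {s<..<T} \<Longrightarrow> 0 < \<eta> t x"
    and ell: "\<And>t x \<xi>. t \<in> {s<..<T} \<Longrightarrow>
        \<eta> t x * (norm \<xi>)\<^sup>2 \<le> (\<Sum>i\<in>UNIV. \<Sum>j\<in>UNIV. Q t x i j * \<xi>$i * \<xi>$j)"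
    and Kb: "\<And>t x. t \<in> {s<..<T} \<Longrightarrow>
        (\<Sum>i\<in>UNIV. (B t x i - (\<Sum>j\<in>UNIV. DQ j i j t x))\<^sup>2) / (4 * (p - 1) * \<eta> t x) - c t x \<le> K"
begin

text \<open>Gronwall's inequality for the energy shifted by \<open>C * \<delta>\<close>. The
  constant \<open>C\<close> collects the error of \<open>tpow'_le\<close> integrated over the box
  and divided by p, so that the shifted energy satisfies a homogeneous inequality with rate p
  K.\<close>

lemma energy_subsolution:
  fixes w Dt :: "real \<Rightarrow> real^'d \<Rightarrow> real"
  assumes \<delta>: "0 < \<delta>"
    and cont: "continuous_on ({s..T} \<times> UNIV) (\<lambda>(t, x). w t x)"
    and Dt: "\<And>t x. t \<in> {s<..<T} \<Longrightarrow> ((\<lambda>\<tau>. w \<tau> x) has_real_derivative Dt t x) (at t)"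
    and Dt_cont: "continuous_on ({s<..<T} \<times> UNIV) (\<lambda>(t, x). Dt t x)"
    and Dw: "\<And>t x i. t \<in> {s<..<T} \<Longrightarrow> has_partial (w t) i x (Dw i t x)"
    and Dw_cont: "\<And>t i. t \<in> {s<..<T} \<Longrightarrow> continuous_on UNIV (Dw i t)"
    and D2w: "\<And>t x i j. t \<in> {s<..<T} \<Longrightarrow> has_partial (Dw j t) i x (D2w i j t x)"
    and D2w_cont: "\<And>t i j. t \<in> {s<..<T} \<Longrightarrow> continuous_on UNIV (D2w i j t)"
    and sub: "\<And>t x. t \<in> {s<..<T} \<Longrightarrow>
        Dt t x \<le> Aop Q B c t x (w t x) (\<lambda>i. Dw i t x) (\<lambda>i j. D2w i j t x)"
    and R: "\<And>t x. t \<in> {s..T} \<Longrightarrow> R < norm x \<Longrightarrow> w t x \<le> 0"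
    and box: "cball 0 R \<subseteq> cbox l r"
    and M: "\<And>t x. t \<in> {s..T} \<Longrightarrow> w t x \<le> M"
  defines "C \<equiv> 3 * M powr (p - 1) * measure lborel (cbox l r) / p"
  shows "integral (cbox l r) (\<lambda>x. tpow p \<delta> (w T x)) + C * \<delta>
    \<le> exp (p * K * (T - s)) * (integral (cbox l r) (\<lambda>x. tpow p \<delta> (w s x)) + C * \<delta>)"
proof -
  define E where "E t = integral (cbox l r) (\<lambda>x. tpow p \<delta> (w t x))" for t
  note tc = tpow_continuous[OF \<delta>, of p]
  note cont_slice = continuous_on_slice[OF cont]
  have comp: "continuous_on S (\<lambda>x. H (v x))" if "continuous_on UNIV H" "continuous_on S v"
    for S and H :: "real \<Rightarrow> real" and v :: "'e::topological_space \<Rightarrow> real"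
    using continuous_on_compose2[OF that] by auto
  have E_cont: "continuous_on {s..T} E"
    unfolding E_def[abs_def]
  proof (rule integral_continuous_on_param)
    show "continuous_on ({s..T} \<times> cbox l r) (\<lambda>(t, x). tpow p \<delta> (w t x))"
      using comp[OF tc(1) continuous_on_subset[OF cont], of "{s..T} \<times> cbox l r"] by (auto simp: split_beta)
  qed
  have E_deriv: "(E has_real_derivative integral (cbox l r) (\<lambda>x. tpow' p \<delta> (w t x) * Dt t x)) (at t)"
    if t: "t \<in> {s<..<T}" for t
  proof -
    have "(E has_real_derivative integral (cbox l r) (\<lambda>x. tpow' p \<delta> (w t x) * Dt t x)) (at t within {s<..<T})"
      unfolding E_def[abs_def]
    proof (rule leibniz_rule_field_derivative[OF _ _ _ t])
      fix \<tau> x assume \<tau>: "\<tau> \<in> {s<..<T}"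
      show "((\<lambda>\<tau>. tpow p \<delta> (w \<tau> x)) has_field_derivative tpow' p \<delta> (w \<tau> x) * Dt \<tau> x) (at \<tau> within {s<..<T})"
        by (rule has_field_derivative_at_within, rule DERIV_chain2[OF tpow_deriv[OF \<delta>] Dt[OF \<tau>]])
    next
      fix \<tau> assume \<tau>: "\<tau> \<in> {s<..<T}"
      then show "(\<lambda>x. tpow p \<delta> (w \<tau> x)) integrable_on cbox l r"
        by (intro integrable_continuous comp[OF tc(1)] continuous_on_subset[OF cont_slice]) auto
    next
      have "continuous_on ({s<..<T} \<times> cbox l r) (\<lambda>z. tpow' p \<delta> (case z of (t, x) \<Rightarrow> w t x) * (case z of (t, x) \<Rightarrow> Dt t x))"
        by (intro continuous_on_mult comp[OF tc(2)] continuous_on_subset[OF cont] continuous_on_subset[OF Dt_cont]) auto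
      then show "continuous_on ({s<..<T} \<times> cbox l r) (\<lambda>(t, x). tpow' p \<delta> (w t x) * Dt t x)"
        by (simp add: split_beta)
    qed simp
    then show ?thesis using t at_within_open[of t "{s<..<T}"] by simp
  qed
  have E_le: "integral (cbox l r) (\<lambda>x. tpow' p \<delta> (w t x) * Dt t x) \<le> p * K * (E t + C * \<delta>)"
    if t: "t \<in> {s<..<T}" for t
  proof -
    have t': "t \<in> {s..T}" using t by auto
    \<comment> \<open>The i-th component of the flux in \<open>energy_pointwise\<close>;
      \<open>F'\<close> is its i-th partial derivative. Both vanish where
      \<open>w t x \<le> \<delta>\<close>, hence outside the ball of radius
      \<open>R\<close>.\<close>
    define F where "F i x = tpow' p \<delta> (w t x) * (\<Sum>j\<in>UNIV. Q t x j i * Dw j t x)" for i x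
    define F' where "F' i x = tpow'' p \<delta> (w t x) * Dw i t x * (\<Sum>j\<in>UNIV. Q t x j i * Dw j t x)
        + tpow' p \<delta> (w t x) * (\<Sum>j\<in>UNIV. DQ i j i t x * Dw j t x + Q t x j i * D2w i j t x)" for i x
    note cs = continuous_on_subset[OF _ subset_UNIV]
    have contw: "continuous_on UNIV (w t)" using cont_slice[OF t'] .
    have contF: "continuous_on UNIV (F i)" and contF': "continuous_on UNIV (F' i)" for i
      unfolding F_def[abs_def] F'_def[abs_def]
      by (intro continuous_intros comp[OF tc(2)] comp[OF tc(3)] contw Q_cont[OF t] Dw_cont[OF t] D2w_cont[OF t] DQ_cont[OF t])+
    have F'0: "integral (cbox l r) (F' i) = 0" for i
    proof (rule integral_partial_eq_0[OF _ contF contF'])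
      fix x show "has_partial (F i) i x (F' i x)"
        unfolding F_def F'_def
        by (rule has_partial_mult[OF has_partial_compose[OF Dw[OF t] tpow'_deriv[OF \<delta>]]
              has_partial_sum[OF has_partial_mult[OF DQ[OF t] D2w[OF t]]]])
    next
      fix x :: "real^'d" assume "R < norm x"
      then have "w t x \<le> \<delta>" using R[OF t'] \<delta> by (meson less_imp_le order.trans)
      then show "F i x = 0" "F' i x = 0" by (simp_all add: F_def F'_def)
    next
      fix x :: "real^'d" assume "norm x \<le> R" then show "x \<in> cbox l r" using box by auto
    qed
    have pw: "tpow' p \<delta> (w t x) * Dt t x \<le> (\<Sum>i\<in>UNIV. F' i x) + K * (p * tpow p \<delta> (w t x) + 3 * \<delta> * M powr (p - 1))" for x
    proof -
      have "tpow' p \<delta> (w t x) * Dt t x \<le> tpow' p \<delta> (w t x) * Aop Q B c t x (w t x) (\<lambda>i. Dw i t x) (\<lambda>i j. D2w i j t x)"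
        by (intro mult_left_mono sub t tpow'_nonneg \<delta> p)
      also have "\<dots> \<le> (\<Sum>i\<in>UNIV. F' i x) + K * (tpow' p \<delta> (w t x) * w t x)"
        unfolding Aop_def F'_def
      proof (rule energy_pointwise[OF p \<eta>[OF t, of x] tpow'_nonneg[OF \<delta> p] tpow''_ge[OF \<delta> p]])
        show "w t x \<le> 0 \<Longrightarrow> tpow' p \<delta> (w t x) = 0 \<and> tpow'' p \<delta> (w t x) = 0" using \<delta> by simp
        show "\<eta> t x * (\<Sum>i\<in>UNIV. (Dw i t x)\<^sup>2) \<le> (\<Sum>i\<in>UNIV. \<Sum>j\<in>UNIV. Q t x i j * Dw i t x * Dw j t x)"
          using ell[OF t, of x "\<chi> i. Dw i t x"] by (simp add: norm_vec_def L2_set_def sum_nonneg)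
        show "\<And>i j. Q t x i j = Q t x j i" by (rule Q_sym[OF t])
        show "(\<Sum>i\<in>UNIV. (B t x i - (\<Sum>j\<in>UNIV. DQ j i j t x))\<^sup>2) / (4 * (p - 1) * \<eta> t x) - c t x \<le> K" by (rule Kb[OF t])
      qed
      also have "K * (tpow' p \<delta> (w t x) * w t x) \<le> K * (p * tpow p \<delta> (w t x) + 3 * \<delta> * M powr (p - 1))"
        using tpow'_le[OF \<delta> p M[OF t', of x]] K by (intro mult_left_mono) (auto simp: mult.commute)
      finally show ?thesis by simp
    qed
    have i1: "F' i integrable_on cbox l r" for i by (rule integrable_continuous[OF cs[OF contF']])
    have i2: "(\<lambda>x. tpow p \<delta> (w t x)) integrable_on cbox l r"
      by (rule integrable_continuous[OF cs[OF comp[OF tc(1) contw]]])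
    have i3: "(\<lambda>x. p * tpow p \<delta> (w t x) + 3 * \<delta> * M powr (p - 1)) integrable_on cbox l r"
      by (intro integrable_continuous continuous_intros cs[OF comp[OF tc(1) contw]])
    have "integral (cbox l r) (\<lambda>x. tpow' p \<delta> (w t x) * Dt t x)
       \<le> integral (cbox l r) (\<lambda>x. (\<Sum>i\<in>UNIV. F' i x) + K * (p * tpow p \<delta> (w t x) + 3 * \<delta> * M powr (p - 1)))"
    proof (rule integral_le)
      show "(\<lambda>x. tpow' p \<delta> (w t x) * Dt t x) integrable_on cbox l r"
        by (intro integrable_continuous continuous_on_mult cs[OF comp[OF tc(2) contw]] cs[OF continuous_on_slice[OF Dt_cont t]])
      show "(\<lambda>x. (\<Sum>i\<in>UNIV. F' i x) + K * (p * tpow p \<delta> (w t x) + 3 * \<delta> * M powr (p - 1))) integrable_on cbox l r"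
        by (intro integrable_add integrable_sum i1 integrable_on_mult_right i3) auto
    qed (rule pw)
    also have "\<dots> = (\<Sum>i\<in>UNIV. integral (cbox l r) (F' i)) + K * (p * E t + 3 * \<delta> * M powr (p - 1) * measure lborel (cbox l r))"
    proof -
      have "integral (cbox l r) (\<lambda>x. p * tpow p \<delta> (w t x) + 3 * \<delta> * M powr (p - 1))
          = p * E t + 3 * \<delta> * M powr (p - 1) * measure lborel (cbox l r)"
        unfolding E_def using i2 by (subst integral_add) (auto simp: integrable_on_mult_right)
      then show ?thesis
        using i1 i3 by (simp add: integral_add integrable_sum integral_sum integrable_on_mult_right)
    qed
    also have "\<dots> = p * K * (E t + C * \<delta>)"
      using p by (simp add: F'0 C_def field_simps)
    finally show ?thesis .
  qed
  \<comment> \<open>Gronwall by an integrating factor. The derivative is known at interior times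
    only; continuity of \<open>E\<close> reaches the endpoints.\<close>
  have "exp (- (p * K * T)) * (E T + C * \<delta>) \<le> exp (- (p * K * s)) * (E s + C * \<delta>)"
  proof (rule DERIV_nonpos_imp_decreasing_open[of s T "\<lambda>t. exp (- (p * K * t)) * (E t + C * \<delta>)"])
    show "s \<le> T" using sT by simp
    show "continuous_on {s..T} (\<lambda>t. exp (- (p * K * t)) * (E t + C * \<delta>))"
      by (intro continuous_intros E_cont)
    fix t assume "s < t" "t < T"
    then have t: "t \<in> {s<..<T}" by simp
    let ?I = "integral (cbox l r) (\<lambda>x. tpow' p \<delta> (w t x) * Dt t x)"
    have "((\<lambda>t. exp (- (p * K * t)) * (E t + C * \<delta>)) has_real_derivative
       exp (- (p * K * t)) * (?I - p * K * (E t + C * \<delta>))) (at t)"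
      by (rule derivative_eq_intros E_deriv[OF t] refl | simp add: algebra_simps)+
    moreover have "exp (- (p * K * t)) * (?I - p * K * (E t + C * \<delta>)) \<le> 0"
      using E_le[OF t] by (simp add: mult_le_0_iff)
    ultimately show "\<exists>y. ((\<lambda>t. exp (- (p * K * t)) * (E t + C * \<delta>)) has_real_derivative y) (at t) \<and> y \<le> 0" by blast
  qed
  then have "exp (p * K * T) * (exp (- (p * K * T)) * (E T + C * \<delta>)) \<le> exp (p * K * T) * (exp (- (p * K * s)) * (E s + C * \<delta>))"
    by (intro mult_left_mono) auto
  then show ?thesis
    by (simp add: E_def mult.assoc[symmetric] right_diff_distrib flip: exp_add)
qed

end

section \<open>The energy inequality for bounded solutions\<close>

text \<open>What the energy method uses of a solution on a finite strip. Joint continuity of u and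
  \<open>Dt\<close> serves the integrals depending on time; the space derivatives are integrated at
  one time only, so continuity in x is enough for them.\<close>

definition bounded_sol where
  "bounded_sol Q B c s T u \<longleftrightarrow>
     continuous_on ({s..T} \<times> UNIV) (\<lambda>(t, x). u t x) \<and>
     bounded ((\<lambda>(t, x). u t x) ` ({s..T} \<times> UNIV)) \<and>
     (\<exists>Dt Du D2u.
       continuous_on ({s<..<T} \<times> UNIV) (\<lambda>(t, x). Dt t x) \<and>
       (\<forall>t\<in>{s<..<T}.
         (\<forall>x. ((\<lambda>\<tau>. u \<tau> x) has_real_derivative Dt t x) (at t)) \<and>
         (\<forall>x i. has_partial (u t) i x (Du i t x)) \<and> (\<forall>i. continuous_on UNIV (Du i t)) \<and>
         (\<forall>x i j. has_partial (Du j t) i x (D2u i j t x)) \<and> (\<forall>i j. continuous_on UNIV (D2u i j t)) \<and>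
         (\<forall>x. Dt t x = Aop Q B c t x (u t x) (\<lambda>i. Du i t x) (\<lambda>i j. D2u i j t x))))"

lemma Aop_diff_cmult:
  "Aop Q B c t x (u - k * v) (\<lambda>i. Du i - k * Dv i) (\<lambda>i j. D2u i j - k * D2v i j)
   = Aop Q B c t x u Du D2u - k * Aop Q B c t x v Dv D2v"
  by (simp add: Aop_def algebra_simps sum_subtractf sum.distrib sum_distrib_left)

lemma has_partial_diff_cmult:
  assumes "has_partial f i x a" "has_partial g i x b"
  shows "has_partial (\<lambda>x. f x - k * g x) i x (a - k * b)"
  using assms unfolding has_partial_def by (auto intro!: derivative_eq_intros)

lemma bounded_sol_diff:
  assumes "bounded_sol Q B c s T u" "bounded_sol Q B c s T v"
  shows "bounded_sol Q B c s T (\<lambda>t x. u t x - v t x)"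
proof -
  obtain Dt Du D2u where u: "continuous_on ({s<..<T} \<times> UNIV) (\<lambda>(t, x). Dt t x)"
     "\<And>t. t \<in> {s<..<T} \<Longrightarrow>
         (\<forall>x. ((\<lambda>\<tau>. u \<tau> x) has_real_derivative Dt t x) (at t)) \<and>
         (\<forall>x i. has_partial (u t) i x (Du i t x)) \<and> (\<forall>i. continuous_on UNIV (Du i t)) \<and>
         (\<forall>x i j. has_partial (Du j t) i x (D2u i j t x)) \<and> (\<forall>i j. continuous_on UNIV (D2u i j t)) \<and>
         (\<forall>x. Dt t x = Aop Q B c t x (u t x) (\<lambda>i. Du i t x) (\<lambda>i j. D2u i j t x))"
    using assms(1) unfolding bounded_sol_def by metis
  obtain Et Dv D2v where v: "continuous_on ({s<..<T} \<times> UNIV) (\<lambda>(t, x). Et t x)"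
     "\<And>t. t \<in> {s<..<T} \<Longrightarrow>
         (\<forall>x. ((\<lambda>\<tau>. v \<tau> x) has_real_derivative Et t x) (at t)) \<and>
         (\<forall>x i. has_partial (v t) i x (Dv i t x)) \<and> (\<forall>i. continuous_on UNIV (Dv i t)) \<and>
         (\<forall>x i j. has_partial (Dv j t) i x (D2v i j t x)) \<and> (\<forall>i j. continuous_on UNIV (D2v i j t)) \<and>
         (\<forall>x. Et t x = Aop Q B c t x (v t x) (\<lambda>i. Dv i t x) (\<lambda>i j. D2v i j t x))"
    using assms(2) unfolding bounded_sol_def by metis
  have a1: "continuous_on ({s..T} \<times> UNIV) (\<lambda>z. (case z of (t, x) \<Rightarrow> u t x) - (case z of (t, x) \<Rightarrow> v t x))"
    using assms by (intro continuous_on_diff) (auto simp: bounded_sol_def)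
  have a2: "bounded ((\<lambda>z. (case z of (t, x) \<Rightarrow> u t x) - (case z of (t, x) \<Rightarrow> v t x)) ` ({s..T} \<times> UNIV))"
    using assms by (intro bounded_minus_comp) (auto simp: bounded_sol_def)
  have a3: "continuous_on ({s<..<T} \<times> UNIV) (\<lambda>z. (case z of (t, x) \<Rightarrow> Dt t x) - (case z of (t, x) \<Rightarrow> Et t x))"
    by (intro continuous_on_diff u v)
  have a4: "(\<forall>x. ((\<lambda>\<tau>. u \<tau> x - v \<tau> x) has_real_derivative Dt t x - Et t x) (at t)) \<and>
         (\<forall>x i. has_partial (\<lambda>x. u t x - v t x) i x (Du i t x - Dv i t x)) \<and> (\<forall>i. continuous_on UNIV (\<lambda>x. Du i t x - Dv i t x)) \<and>
         (\<forall>x i j. has_partial (\<lambda>x. Du j t x - Dv j t x) i x (D2u i j t x - D2v i j t x)) \<and> (\<forall>i j. continuous_on UNIV (\<lambda>x. D2u i j t x - D2v i j t x)) \<and>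
         (\<forall>x. Dt t x - Et t x = Aop Q B c t x (u t x - v t x) (\<lambda>i. Du i t x - Dv i t x) (\<lambda>i j. D2u i j t x - D2v i j t x))"
     if "t \<in> {s<..<T}" for t
    using u(2)[OF that] v(2)[OF that]
    by (auto intro!: continuous_on_diff DERIV_diff has_partial_diff_cmult[where k=1, simplified] simp: Aop_diff_cmult[where k=1, simplified])
  show ?thesis
    unfolding bounded_sol_def split_beta
    by (rule conjI, rule a1[unfolded split_beta], rule conjI, rule a2[unfolded split_beta],
        rule exI[of _ "\<lambda>t x. Dt t x - Et t x"], rule exI[of _ "\<lambda>i t x. Du i t x - Dv i t x"],
        rule exI[of _ "\<lambda>i j t x. D2u i j t x - D2v i j t x"], rule conjI, rule a3[unfolded split_beta],
        rule ballI, rule a4)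
qed

context dissipative_coefficients
begin

text \<open>Nonnegative integrals allow an infinite right-hand side, so no integrability of u is
  presupposed; the estimate itself carries it from time s to time T.\<close>

lemma sol_energy:
  fixes u :: "real \<Rightarrow> real^'d \<Rightarrow> real"
  assumes sol: "bounded_sol Q B c s T u"
    and \<phi>: "C2_with \<phi> D\<phi> D2\<phi>" "\<And>x. 0 < \<phi> x" "filterlim \<phi> at_top at_infinity"
    and lyap: "\<And>t x. t \<in> {s<..<T} \<Longrightarrow>
        Aop Q B c t x (\<phi> x) (\<lambda>i. D\<phi> i x) (\<lambda>i j. D2\<phi> i j x) \<le> lam * \<phi> x" and lam: "0 \<le> lam"
  shows "(\<integral>\<^sup>+x. ennreal (max 0 (u T x) powr p) \<partial>lborel)
    \<le> ennreal (exp (p * K * (T - s))) * (\<integral>\<^sup>+x. ennreal (max 0 (u s x) powr p) \<partial>lborel)"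
    (is "?L \<le> ?e * ?S")
proof -
  obtain Dt Du D2u where u: "continuous_on ({s<..<T} \<times> UNIV) (\<lambda>(t, x). Dt t x)"
     "\<And>t. t \<in> {s<..<T} \<Longrightarrow>
         (\<forall>x. ((\<lambda>\<tau>. u \<tau> x) has_real_derivative Dt t x) (at t)) \<and>
         (\<forall>x i. has_partial (u t) i x (Du i t x)) \<and> (\<forall>i. continuous_on UNIV (Du i t)) \<and>
         (\<forall>x i j. has_partial (Du j t) i x (D2u i j t x)) \<and> (\<forall>i j. continuous_on UNIV (D2u i j t)) \<and>
         (\<forall>x. Dt t x = Aop Q B c t x (u t x) (\<lambda>i. Du i t x) (\<lambda>i j. D2u i j t x))"
    using sol unfolding bounded_sol_def by metis
  have u_cont: "continuous_on ({s..T} \<times> UNIV) (\<lambda>(t, x). u t x)"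
    using sol unfolding bounded_sol_def by blast
  have u_slice: "continuous_on UNIV (u t)" if "t \<in> {s..T}" for t
    by (rule continuous_on_slice[OF u_cont that])
  obtain M where M: "\<And>t x. t \<in> {s..T} \<Longrightarrow> u t x \<le> M"
  proof -
    have "bounded ((\<lambda>(t, x). u t x) ` ({s..T} \<times> UNIV))"
      using sol unfolding bounded_sol_def by blast
    then obtain M where "\<forall>z\<in>(\<lambda>(t, x). u t x) ` ({s..T} \<times> UNIV). norm z \<le> M"
      unfolding bounded_iff by blast
    then have "u t x \<le> M" if "t \<in> {s..T}" for t x
      using that by (fastforce simp: abs_le_iff)
    then show thesis by (rule that)
  qed
  have \<phi>_cont: "continuous_on UNIV \<phi>" "\<And>i. continuous_on UNIV (D\<phi> i)" "\<And>i j. continuous_on UNIV (D2\<phi> i j)"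
    and \<phi>_part: "\<And>i x. has_partial \<phi> i x (D\<phi> i x)" "\<And>i j x. has_partial (D\<phi> j) i x (D2\<phi> i j x)"
    using \<phi>(1) unfolding C2_with_def by auto
  define w where "w \<epsilon> t x = u t x - \<epsilon> * exp (lam * (t - s)) * \<phi> x" for \<epsilon> t x
  have w_slice: "continuous_on UNIV (w \<epsilon> t)" if "t \<in> {s..T}" for t \<epsilon>
    unfolding w_def[abs_def] by (intro continuous_intros u_slice that \<phi>_cont)
  have w_le: "w \<epsilon> t x \<le> u t x" if "0 < \<epsilon>" for \<epsilon> t x
    using that \<phi>(2)[of x] by (simp add: w_def)
  have step: "\<exists>\<delta>>0. \<delta> \<le> \<epsilon> \<and> (\<integral>\<^sup>+x. ennreal (tpow p \<delta> (w \<epsilon> T x)) \<partial>lborel) \<le> ?e * (?S + ennreal \<epsilon>)" if \<epsilon>: "0 < \<epsilon>" for \<epsilon>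
  proof -
    have "\<forall>\<^sub>F x in at_infinity. M / \<epsilon> \<le> \<phi> x" using \<phi>(3) by (simp add: filterlim_at_top)
    then obtain R where R: "\<And>x. R \<le> norm x \<Longrightarrow> M / \<epsilon> \<le> \<phi> x" by (auto simp: eventually_at_infinity)
    have wR: "w \<epsilon> t x \<le> 0" if "t \<in> {s..T}" "R < norm x" for t x
    proof -
      have "M \<le> \<epsilon> * \<phi> x" using R[of x] that \<epsilon> by (simp add: field_simps)
      also have "\<dots> = \<epsilon> * 1 * \<phi> x" by simp
      \<comment> \<open>Since \<open>lam\<close> is nonnegative the exponential is at least 1, so
        one radius works for all times of the strip.\<close>
      also have "\<dots> \<le> \<epsilon> * exp (lam * (t - s)) * \<phi> x"
        using \<epsilon> lam that \<phi>(2)[of x] by (intro mult_right_mono mult_left_mono) auto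
      finally show ?thesis using M[OF that(1), of x] by (simp add: w_def)
    qed
    obtain m where m: "cball 0 R \<subseteq> cbox (- m) (m :: real^'d)"
      using bounded_subset_cbox_symmetric[of "cball 0 R"] by auto
    define C where "C = 3 * M powr (p - 1) * measure lborel (cbox (- m) m) / p"
    have C: "0 \<le> C" using p by (simp add: C_def)
    \<comment> \<open>\<open>C\<close> depends on the box and thus on \<epsilon>, so \<delta> is
      fixed only now. The summand 1 covers \<open>C = 0\<close> and gives
      \<open>\<delta> \<le> \<epsilon>\<close>.\<close>
    define \<delta> where "\<delta> = \<epsilon> / (C + 1)"
    have \<delta>: "0 < \<delta>" "\<delta> \<le> \<epsilon>" "C * \<delta> \<le> \<epsilon>" using C \<epsilon> by (auto simp: \<delta>_def field_simps)
    have "integral (cbox (- m) m) (\<lambda>x. tpow p \<delta> (w \<epsilon> T x)) + C * \<delta>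
      \<le> exp (p * K * (T - s)) * (integral (cbox (- m) m) (\<lambda>x. tpow p \<delta> (w \<epsilon> s x)) + C * \<delta>)"
      unfolding C_def
    proof (rule energy_subsolution[OF \<delta>(1), where w="w \<epsilon>" and R=R
            and Dt="\<lambda>t x. Dt t x - \<epsilon> * exp (lam * (t - s)) * (lam * \<phi> x)"
            and Dw="\<lambda>i t x. Du i t x - \<epsilon> * exp (lam * (t - s)) * D\<phi> i x"
            and D2w="\<lambda>i j t x. D2u i j t x - \<epsilon> * exp (lam * (t - s)) * D2\<phi> i j x"])
      show "continuous_on ({s..T} \<times> UNIV) (\<lambda>(t, x). w \<epsilon> t x)"
        unfolding w_def split_beta
        by (intro continuous_intros continuous_on_compose2[OF \<phi>_cont(1)] u_cont[unfolded split_beta]) auto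
      show "continuous_on ({s<..<T} \<times> UNIV) (\<lambda>(t, x). Dt t x - \<epsilon> * exp (lam * (t - s)) * (lam * \<phi> x))"
        unfolding split_beta
        by (intro continuous_intros continuous_on_compose2[OF \<phi>_cont(1)] u(1)[unfolded split_beta]) auto
      fix t assume t: "t \<in> {s<..<T}"
      note ut = u(2)[OF t]
      have t': "t \<in> {s..T}" using t by auto
      show "((\<lambda>\<tau>. w \<epsilon> \<tau> x) has_real_derivative Dt t x - \<epsilon> * exp (lam * (t - s)) * (lam * \<phi> x)) (at t)" for x
        unfolding w_def by (rule derivative_eq_intros ut[THEN conjunct1, rule_format] refl | simp)+
      show "has_partial (w \<epsilon> t) i x (Du i t x - \<epsilon> * exp (lam * (t - s)) * D\<phi> i x)" for i x
        unfolding w_def[abs_def] using ut \<phi>_part by (intro has_partial_diff_cmult) auto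
      show "has_partial (\<lambda>x. Du j t x - \<epsilon> * exp (lam * (t - s)) * D\<phi> j x) i x (D2u i j t x - \<epsilon> * exp (lam * (t - s)) * D2\<phi> i j x)" for i j x
        using ut \<phi>_part by (intro has_partial_diff_cmult) auto
      show "continuous_on UNIV (\<lambda>x. Du i t x - \<epsilon> * exp (lam * (t - s)) * D\<phi> i x)" for i
        using ut \<phi>_cont by (intro continuous_intros) auto
      show "continuous_on UNIV (\<lambda>x. D2u i j t x - \<epsilon> * exp (lam * (t - s)) * D2\<phi> i j x)" for i j
        using ut \<phi>_cont by (intro continuous_intros) auto
      show "Dt t x - \<epsilon> * exp (lam * (t - s)) * (lam * \<phi> x) \<le> Aop Q B c t x (w \<epsilon> t x)
          (\<lambda>i. Du i t x - \<epsilon> * exp (lam * (t - s)) * D\<phi> i x) (\<lambda>i j. D2u i j t x - \<epsilon> * exp (lam * (t - s)) * D2\<phi> i j x)" for x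
        unfolding w_def Aop_diff_cmult using ut lyap[OF t, of x] \<epsilon> by (auto intro!: mult_left_mono)
    next
      fix t x assume "t \<in> {s..T}"
      then show "w \<epsilon> t x \<le> M" using M w_le[OF \<epsilon>] order.trans by blast
    qed (use wR m in auto)
    moreover have "0 \<le> C * \<delta>" using C \<delta> by simp
    ultimately have *: "integral (cbox (- m) m) (\<lambda>x. tpow p \<delta> (w \<epsilon> T x))
      \<le> exp (p * K * (T - s)) * (integral (cbox (- m) m) (\<lambda>x. tpow p \<delta> (w \<epsilon> s x)) + \<epsilon>)"
      using \<delta>(3) by (smt (verit) exp_gt_zero mult_left_mono)
    have nn: "(\<integral>\<^sup>+x. ennreal (tpow p \<delta> (w \<epsilon> t x)) \<partial>lborel) = ennreal (integral (cbox (- m) m) (\<lambda>x. tpow p \<delta> (w \<epsilon> t x)))"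
      if t: "t \<in> {s..T}" for t
    proof -
      have c: "continuous_on UNIV (\<lambda>x. tpow p \<delta> (w \<epsilon> t x))"
        using continuous_on_compose2[OF tpow_continuous(1)[OF \<delta>(1)] w_slice[OF t]] by auto
      have z: "tpow p \<delta> (w \<epsilon> t x) = 0" if "x \<notin> cbox (- m) m" for x
      proof -
        have "x \<notin> cball 0 R" using m that by blast
        then have "w \<epsilon> t x \<le> 0" by (intro wR[OF t]) simp
        then show ?thesis using \<delta>(1) by simp
      qed
      show ?thesis
        using integral_cbox_eq_lborel[OF c z] by (simp add: nn_integral_eq_integral tpow_nonneg)
    qed
    have "(\<integral>\<^sup>+x. ennreal (tpow p \<delta> (w \<epsilon> T x)) \<partial>lborel)
      \<le> ennreal (exp (p * K * (T - s)) * (integral (cbox (- m) m) (\<lambda>x. tpow p \<delta> (w \<epsilon> s x)) + \<epsilon>))"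
      using sT * by (subst nn) (auto intro: ennreal_leI)
    also have "\<dots> = ?e * ((\<integral>\<^sup>+x. ennreal (tpow p \<delta> (w \<epsilon> s x)) \<partial>lborel) + ennreal \<epsilon>)"
    proof -
      have s: "s \<in> {s..T}" using sT by simp
      have "(\<lambda>x. tpow p \<delta> (w \<epsilon> s x)) integrable_on cbox (- m) m"
        by (intro integrable_continuous continuous_on_compose2[OF tpow_continuous(1)[OF \<delta>(1)] continuous_on_subset[OF w_slice[OF s]]]) auto
      then have "0 \<le> integral (cbox (- m) m) (\<lambda>x. tpow p \<delta> (w \<epsilon> s x))"
        by (rule Henstock_Kurzweil_Integration.integral_nonneg) (rule tpow_nonneg)
      then show ?thesis using \<epsilon> by (simp add: nn[OF s] ennreal_mult ennreal_plus)
    qed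
    also have "\<dots> \<le> ?e * (?S + ennreal \<epsilon>)"
    proof (intro mult_left_mono add_right_mono nn_integral_mono ennreal_leI)
      fix x
      have "tpow p \<delta> (w \<epsilon> s x) \<le> max 0 (w \<epsilon> s x) powr p" using \<delta>(1) by (intro tpow_le) simp
      also have "\<dots> \<le> max 0 (u s x) powr p"
        using w_le[OF \<epsilon>, of s x] p by (intro powr_mono2) auto
      finally show "tpow p \<delta> (w \<epsilon> s x) \<le> max 0 (u s x) powr p" .
    qed simp
    finally show ?thesis using \<delta> by blast
  qed
  define \<epsilon> where "\<epsilon> n = inverse (real (Suc n))" for n
  have \<epsilon>: "0 < \<epsilon> n" for n by (simp add: \<epsilon>_def)
  have \<epsilon>0: "\<epsilon> \<longlonglongrightarrow> 0" unfolding \<epsilon>_def[abs_def] by (rule LIMSEQ_inverse_real_of_nat)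
  obtain \<delta> where \<delta>: "\<And>n. 0 < \<delta> n" "\<And>n. \<delta> n \<le> \<epsilon> n"
    "\<And>n. (\<integral>\<^sup>+x. ennreal (tpow p (\<delta> n) (w (\<epsilon> n) T x)) \<partial>lborel) \<le> ?e * (?S + ennreal (\<epsilon> n))"
    using step[OF \<epsilon>] by metis
  have \<delta>0: "\<delta> \<longlonglongrightarrow> 0"
    by (rule tendsto_sandwich[OF _ _ tendsto_const \<epsilon>0]) (use \<delta> in \<open>auto intro!: always_eventually less_imp_le\<close>)
  have lim: "(\<lambda>n. ennreal (tpow p (\<delta> n) (w (\<epsilon> n) T x))) \<longlonglongrightarrow> ennreal (max 0 (u T x) powr p)" for x
  proof (intro tendsto_ennrealI tpow_tendsto \<delta>0 \<delta>(1))
    have "(\<lambda>n. w (\<epsilon> n) T x) \<longlonglongrightarrow> u T x - 0 * exp (lam * (T - s)) * \<phi> x"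
      unfolding w_def by (intro tendsto_intros \<epsilon>0)
    then show "(\<lambda>n. w (\<epsilon> n) T x) \<longlonglongrightarrow> u T x" by simp
    show "\<forall>\<^sub>F n in sequentially. w (\<epsilon> n) T x \<le> 0" if "u T x \<le> 0"
      using w_le[OF \<epsilon>, of _ T x] that order.trans by (intro always_eventually allI) blast
  qed
  \<comment> \<open>Fatou's lemma handles time T. At time s no limit of integrals is needed, because
    w lies below u and \<open>tpow\<close> below the power.\<close>
  have "?L = (\<integral>\<^sup>+x. liminf (\<lambda>n. ennreal (tpow p (\<delta> n) (w (\<epsilon> n) T x))) \<partial>lborel)"
    by (intro nn_integral_cong lim_imp_Liminf[symmetric] lim) simp
  also have "\<dots> \<le> liminf (\<lambda>n. \<integral>\<^sup>+x. ennreal (tpow p (\<delta> n) (w (\<epsilon> n) T x)) \<partial>lborel)"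
  proof (rule nn_integral_liminf)
    fix n
    have "continuous_on UNIV (\<lambda>x. tpow p (\<delta> n) (w (\<epsilon> n) T x))"
      using sT continuous_on_compose2[OF tpow_continuous(1)[OF \<delta>(1)] w_slice[of T]] by auto
    then show "(\<lambda>x. ennreal (tpow p (\<delta> n) (w (\<epsilon> n) T x))) \<in> borel_measurable lborel"
      by (intro measurable_compose[OF _ measurable_ennreal]) (simp add: borel_measurable_continuous_onI)
  qed
  also have "\<dots> \<le> liminf (\<lambda>n. ?e * (?S + ennreal (\<epsilon> n)))"
    by (intro Liminf_mono always_eventually allI \<delta>(3))
  also have "\<dots> = ?e * (?S + ennreal 0)"
    by (intro lim_imp_Liminf ennreal_tendsto_cmult tendsto_add tendsto_const tendsto_ennrealI \<epsilon>0) auto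
  finally show ?thesis by simp
qed

end

section \<open>Uniqueness for the Cauchy problem\<close>

text \<open>The set where f is positive is open, and a nonempty open set is not negligible.\<close>

lemma AE_nonpos_imp_nonpos:
  fixes f :: "'a::euclidean_space \<Rightarrow> real"
  assumes "continuous_on UNIV f" "AE x in lborel. f x \<le> 0"
  shows "f x \<le> 0"
proof (rule ccontr)
  assume x: "\<not> f x \<le> 0"
  have o: "open {x. \<not> f x \<le> 0}"
    using open_Collect_less[OF continuous_on_const[of _ 0] assms(1)] by (simp add: not_le)
  then have "{x. \<not> f x \<le> 0} \<in> null_sets lborel"
    using assms(2) AE_iff_null_sets[of "{x. \<not> f x \<le> 0}" lborel] by simp
  then have "negligible {x. \<not> f x \<le> 0}"
    by (simp add: negligible_iff_null_sets null_sets_completionI)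
  then show False using open_not_negligible[OF o] x by blast
qed

context dissipative_coefficients
begin

text \<open>The energy controls positive parts only, so it is applied to u - v and to v - u. Equal
  initial data make the right-hand side zero, and continuity turns the resulting almost-everywhere
  inequality into one at every point.\<close>

lemma bounded_sol_unique:
  assumes "bounded_sol Q B c s T u" "bounded_sol Q B c s T v" "u s = v s"
    and \<phi>: "C2_with \<phi> D\<phi> D2\<phi>" "\<And>x. 0 < \<phi> x" "filterlim \<phi> at_top at_infinity"
    and lyap: "\<And>t x. t \<in> {s<..<T} \<Longrightarrow>
        Aop Q B c t x (\<phi> x) (\<lambda>i. D\<phi> i x) (\<lambda>i j. D2\<phi> i j x) \<le> lam * \<phi> x" and lam: "0 \<le> lam"
  shows "u T = v T"
proof -
  have le: "u T x \<le> v T x" if sol: "bounded_sol Q B c s T u" "bounded_sol Q B c s T v" and eq: "u s = v s" for u v x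
  proof -
    note d = bounded_sol_diff[OF sol]
    have c: "continuous_on UNIV (\<lambda>x. u T x - v T x)"
      using d sT continuous_on_slice[of "{s..T}" UNIV "\<lambda>t x. u t x - v t x" T] unfolding bounded_sol_def by auto
    have [measurable]: "(\<lambda>x. u T x - v T x) \<in> borel_measurable borel" by (rule borel_measurable_continuous_onI[OF c])
    have "(\<integral>\<^sup>+x. ennreal (max 0 (u T x - v T x) powr p) \<partial>lborel) = 0"
      using sol_energy[OF d \<phi> lyap lam] eq by simp
    then have "AE x in lborel. ennreal (max 0 (u T x - v T x) powr p) = 0"
      by (subst (asm) nn_integral_0_iff_AE) auto
    then have "AE x in lborel. u T x - v T x \<le> 0"
      by (rule eventually_mono) (auto simp: max_def split: if_splits)
    from AE_nonpos_imp_nonpos[OF c this, of x] show ?thesis by simp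
  qed
  show ?thesis
    using le[OF assms(1,2,3)] le[OF assms(2,1) assms(3)[symmetric]] by (intro ext order.antisym)
qed

end

section \<open>The Cauchy problem and the Green function\<close>

lemma holder_loc_continuous_on_compact:
  assumes "holder_loc \<alpha> S F" "0 < \<alpha>" "compact K" "K \<subseteq> S"
  shows "continuous_on K (\<lambda>(t, x). F t x)"
proof -
  obtain C where C: "\<forall>t x s y. (t, x) \<in> K \<and> (s, y) \<in> K \<longrightarrow>
      \<bar>F t x - F s y\<bar> \<le> C * (\<bar>t - s\<bar> powr (\<alpha>/2) + dist x y powr \<alpha>)"
    using assms(1)[unfolded holder_loc_def, rule_format, OF conjI[OF assms(3,4)]] ..
  have "((\<lambda>z. case z of (t, x) \<Rightarrow> F t x) \<longlongrightarrow> F s y) (at (s, y) within K)" if sy: "(s, y) \<in> K" for s y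
  proof (rule LIM_zero_cancel, rule Lim_null_comparison)
    show "\<forall>\<^sub>F z in at (s, y) within K. norm ((case z of (t, x) \<Rightarrow> F t x) - F s y)
        \<le> C * (\<bar>fst z - s\<bar> powr (\<alpha>/2) + dist (snd z) y powr \<alpha>)"
      unfolding eventually_at_filter
    proof (intro always_eventually allI impI)
      fix z assume "z \<in> K"
      then show "norm ((case z of (t, x) \<Rightarrow> F t x) - F s y) \<le> C * (\<bar>fst z - s\<bar> powr (\<alpha>/2) + dist (snd z) y powr \<alpha>)"
        using C[rule_format, of "fst z" "snd z" s y] sy by (simp add: split_beta)
    qed
    have "((\<lambda>z. C * (\<bar>fst z - s\<bar> powr (\<alpha>/2) + dist (snd z) y powr \<alpha>)) \<longlongrightarrow>
        C * (\<bar>fst (s, y) - s\<bar> powr (\<alpha>/2) + dist (snd (s, y)) y powr \<alpha>)) (at (s, y) within K)"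
      using \<open>0 < \<alpha>\<close> by (intro tendsto_intros tendsto_powr') auto
    then show "((\<lambda>z. C * (\<bar>fst z - s\<bar> powr (\<alpha>/2) + dist (snd z) y powr \<alpha>)) \<longlongrightarrow> 0) (at (s, y) within K)"
      by simp
  qed
  then show ?thesis unfolding continuous_on_def by auto
qed

lemma holder_loc_continuous_on_open:
  assumes "holder_loc \<alpha> S F" "0 < \<alpha>" "open S"
  shows "continuous_on S (\<lambda>(t, x). F t x)"
  unfolding continuous_on_eq_continuous_at[OF assms(3)]
proof
  fix z assume "z \<in> S"
  then obtain r where r: "0 < r" "cball z r \<subseteq> S" using assms(3) open_contains_cball by blast
  then have "continuous_on (cball z r) (\<lambda>(t, x). F t x)"
    by (intro holder_loc_continuous_on_compact[OF assms(1,2)]) auto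
  then show "isCont (\<lambda>(t, x). F t x) z"
    using r by (intro continuous_on_interior[of "cball z r"]) (auto simp: interior_cball)
qed

text \<open>The set \<open>I\<close> may contain its left endpoint, so
  \<open>I \<times> UNIV\<close> need not be open; the compact sets
  \<open>{t} \<times> cball x 1\<close> avoid neighbourhoods in time.\<close>

lemma holder_loc_continuous_on_slice:
  assumes "holder_loc \<alpha> (I \<times> UNIV) F" "0 < \<alpha>" "t \<in> I"
  shows "continuous_on UNIV (F t)"
  unfolding continuous_on_eq_continuous_at[OF open_UNIV]
proof
  fix x
  have "continuous_on ({t} \<times> cball x 1) (\<lambda>(t, x). F t x)"
    using assms(3) by (intro holder_loc_continuous_on_compact[OF assms(1,2)] compact_Times) auto
  then have "continuous_on (cball x 1) (F t)" by (rule continuous_on_slice) simp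
  then show "isCont (F t) x"
    by (intro continuous_on_interior[of "cball x 1"]) (auto simp: interior_cball)
qed

lemma cauchy_sol_imp_bounded_sol:
  assumes "cauchy_sol \<alpha> Q B c s f u" "0 < \<alpha>" "s < T"
  shows "bounded_sol Q B c s T u"
proof -
  obtain Dt Du D2u where u: "C12_holder_loc_with \<alpha> ({s<..} \<times> UNIV) u Dt Du D2u"
    and pde: "\<And>t x. t > s \<Longrightarrow> Dt t x = Aop Q B c t x (u t x) (\<lambda>i. Du i t x) (\<lambda>i j. D2u i j t x)"
    using assms(1) unfolding cauchy_sol_def by blast
  have o: "open ({s<..} \<times> (UNIV :: (real^'a) set))" by (intro open_Times) auto
  have 1: "continuous_on ({s..T} \<times> UNIV) (\<lambda>(t, x). u t x)"
    using assms(1) unfolding cauchy_sol_def by (elim conjE, elim continuous_on_subset) auto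
  have 2: "bounded ((\<lambda>(t, x). u t x) ` ({s..T} \<times> UNIV))"
    using assms(1,3) unfolding cauchy_sol_def by blast
  have 3: "continuous_on ({s<..<T} \<times> UNIV) (\<lambda>(t, x). Dt t x)"
    by (rule continuous_on_subset[OF holder_loc_continuous_on_open[OF _ assms(2) o]])
      (use u in \<open>auto simp: C12_holder_loc_with_def\<close>)
  have 4: "(\<forall>x. ((\<lambda>\<tau>. u \<tau> x) has_real_derivative Dt t x) (at t)) \<and>
         (\<forall>x i. has_partial (u t) i x (Du i t x)) \<and> (\<forall>i. continuous_on UNIV (Du i t)) \<and>
         (\<forall>x i j. has_partial (Du j t) i x (D2u i j t x)) \<and> (\<forall>i j. continuous_on UNIV (D2u i j t)) \<and>
         (\<forall>x. Dt t x = Aop Q B c t x (u t x) (\<lambda>i. Du i t x) (\<lambda>i j. D2u i j t x))"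
    if "t \<in> {s<..<T}" for t
  proof -
    have "continuous_on UNIV (Du i t)" "continuous_on UNIV (D2u i j t)" for i j
      by (rule holder_loc_continuous_on_slice[OF _ assms(2), of "{s<..}"];
          use that u in \<open>simp add: C12_holder_loc_with_def\<close>)+
    moreover have "t > s" using that by simp
    ultimately show ?thesis using u pde unfolding C12_holder_loc_with_def by auto
  qed
  show ?thesis
    unfolding bounded_sol_def
    by (rule conjI, rule 1, rule conjI, rule 2, rule exI[of _ Dt], rule exI[of _ Du],
        rule exI[of _ D2u], rule conjI, rule 3, rule ballI, rule 4)
qed

lemma holder_loc_cmult:
  assumes "holder_loc \<alpha> S F"
  shows "holder_loc \<alpha> S (\<lambda>t x. k * F t x)"
  unfolding holder_loc_def
proof (intro allI impI)
  fix A assume "compact A \<and> A \<subseteq> S"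
  then obtain C where C: "\<And>t x s y. (t, x) \<in> A \<and> (s, y) \<in> A \<Longrightarrow>
      \<bar>F t x - F s y\<bar> \<le> C * (\<bar>t - s\<bar> powr (\<alpha>/2) + dist x y powr \<alpha>)"
    using assms[unfolded holder_loc_def, rule_format, of A] by auto
  show "\<exists>C. \<forall>t x s y. (t, x) \<in> A \<and> (s, y) \<in> A \<longrightarrow>
      \<bar>k * F t x - k * F s y\<bar> \<le> C * (\<bar>t - s\<bar> powr (\<alpha>/2) + dist x y powr \<alpha>)"
  proof (intro exI[of _ "\<bar>k\<bar> * C"] allI impI)
    fix t x s y assume "(t, x) \<in> A \<and> (s, y) \<in> A"
    from mult_left_mono[OF C[OF this], of "\<bar>k\<bar>"]
    show "\<bar>k * F t x - k * F s y\<bar> \<le> \<bar>k\<bar> * C * (\<bar>t - s\<bar> powr (\<alpha>/2) + dist x y powr \<alpha>)"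
      by (simp add: abs_mult[symmetric] right_diff_distrib mult.assoc)
  qed
qed

text \<open>Used with k = 1/2: a solution for the datum 2 f would yield one for f.\<close>

lemma cauchy_sol_cmult:
  assumes "cauchy_sol \<alpha> Q B c s f u"
  shows "cauchy_sol \<alpha> Q B c s (\<lambda>x. k * f x) (\<lambda>t x. k * u t x)"
proof -
  obtain Dt Du D2u where u: "C12_holder_loc_with \<alpha> ({s<..} \<times> UNIV) u Dt Du D2u"
    and pde: "\<And>t x. t > s \<Longrightarrow> Dt t x = Aop Q B c t x (u t x) (\<lambda>i. Du i t x) (\<lambda>i j. D2u i j t x)"
    using assms(1) unfolding cauchy_sol_def by blast
  have "C12_holder_loc_with \<alpha> ({s<..} \<times> UNIV) (\<lambda>t x. k * u t x) (\<lambda>t x. k * Dt t x)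
      (\<lambda>i t x. k * Du i t x) (\<lambda>i j t x. k * D2u i j t x)"
    using u unfolding C12_holder_loc_with_def has_partial_def
    by (auto intro!: holder_loc_cmult DERIV_cmult)
  moreover have "k * Dt t x = Aop Q B c t x (k * u t x) (\<lambda>i. k * Du i t x) (\<lambda>i j. k * D2u i j t x)" if "t > s" for t x
    unfolding pde[OF that] Aop_def by (simp add: algebra_simps sum_distrib_left)
  moreover have "continuous_on ({s..} \<times> UNIV) (\<lambda>(t, x). k * u t x)"
    using assms unfolding cauchy_sol_def split_beta by (intro continuous_on_mult_left) auto
  moreover have "bounded ((\<lambda>(t, x). k * u t x) ` ({s..T} \<times> UNIV))" if "T > s" for T
  proof -
    have "bounded ((\<lambda>z. k *\<^sub>R z) ` (\<lambda>(t, x). u t x) ` ({s..T} \<times> UNIV))"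
      using assms that unfolding cauchy_sol_def by (intro bounded_scaling) blast
    then show ?thesis by (simp add: image_image split_beta)
  qed
  moreover have "k * u s x = k * f x" for x using assms unfolding cauchy_sol_def by simp
  ultimately show ?thesis unfolding cauchy_sol_def by blast
qed

text \<open>If the Cauchy problem had no solution for \<open>f\<close>, it would have none for \<open>2 f\<close> either, and \<open>evol\<close> would return
  the same junk value for both; linearity of the integral would make that value \<open>0\<close>, whereas \<open>g > 0\<close>.\<close>

lemma cauchy_sol_exists_green:
  assumes green: "green_fun \<alpha> I Q B c g" and s: "s \<in> I" "s < t"
    and uniq: "\<And>f u v. cauchy_sol \<alpha> Q B c s f u \<Longrightarrow> cauchy_sol \<alpha> Q B c s f v \<Longrightarrow> u t = v t"
    and f: "f \<in> Cb" "\<And>x. 0 \<le> f x" "f y0 \<noteq> 0"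
  shows "\<exists>u. cauchy_sol \<alpha> Q B c s f u \<and> (\<forall>x. u t x = (LINT y|lebesgue. g t s x y * f y))"
proof -
  have g: "integrable lebesgue (\<lambda>y. g t s x y * f y)" "evol \<alpha> Q B c t s f x = (LINT y|lebesgue. g t s x y * f y)"
    if "f \<in> Cb" for f x
    using green s that unfolding green_fun_def by auto
  have ex: "\<exists>u. cauchy_sol \<alpha> Q B c s f u"
  proof (rule ccontr)
    assume no: "\<not> ?thesis"
    have no2: "\<not> cauchy_sol \<alpha> Q B c s (\<lambda>x. 2 * f x) u" for u
      using no cauchy_sol_cmult[of \<alpha> Q B c s "\<lambda>x. 2 * f x" u "1/2"] by auto
    have f2: "(\<lambda>x. 2 * f x) \<in> Cb"
    proof -
      have "bounded ((\<lambda>z. 2 *\<^sub>R z) ` range f)" using f(1) by (intro bounded_scaling) (simp add: Cb_def)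
      then show ?thesis using f(1) by (auto simp: Cb_def image_image intro!: continuous_intros)
    qed
    have "evol \<alpha> Q B c t s (\<lambda>x. 2 * f x) = evol \<alpha> Q B c t s f"
      unfolding evol_def using no no2 s by simp
    then have "(LINT y|lebesgue. g t s 0 y * (2 * f y)) = (LINT y|lebesgue. g t s 0 y * f y)"
      using g(2)[OF f(1), of 0] g(2)[OF f2, of 0] by simp
    moreover have "(LINT y|lebesgue. g t s 0 y * (2 * f y)) = 2 * (LINT y|lebesgue. g t s 0 y * f y)"
      using integral_mult_right_zero[of lebesgue 2 "\<lambda>y. g t s 0 y * f y"] by (simp add: mult.left_commute)
    ultimately have "(LINT y|lebesgue. g t s 0 y * f y) = 0" by simp
    moreover have gpos: "0 < g t s 0 y" for y
      using green s unfolding green_fun_def by blast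
    then have "0 \<le> g t s 0 y * f y" for y
      using f(2)[of y] by (simp add: less_imp_le)
    ultimately have "AE y in lebesgue. g t s 0 y * f y = 0"
      using integral_nonneg_eq_0_iff_AE[OF g(1)[OF f(1)]] by auto
    then have "AE y in lebesgue. f y = 0"
      by (rule eventually_mono) (use gpos in \<open>simp add: less_imp_neq[symmetric]\<close>)
    then have "AE y in lborel. f y = 0" by (simp add: AE_completion_iff)
    then have "AE y in lborel. f y \<le> 0" by (rule eventually_mono) simp
    then have "f y0 \<le> 0" using f(1) by (intro AE_nonpos_imp_nonpos) (auto simp: Cb_def)
    with f(2)[of y0] have "f y0 = 0" by simp
    with f(3) show False by simp
  qed
  then obtain u where u: "cauchy_sol \<alpha> Q B c s f u" by blast
  \<comment> \<open>The description ranges over values at time t, so agreement of solutions at that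
    one time makes it well defined.\<close>
  have "(THE v. \<exists>u. cauchy_sol \<alpha> Q B c s f u \<and> v = u t) = u t"
  proof (rule the_equality)
    show "\<exists>u'. cauchy_sol \<alpha> Q B c s f u' \<and> u t = u' t" using u by blast
    show "v = u t" if "\<exists>u. cauchy_sol \<alpha> Q B c s f u \<and> v = u t" for v using that uniq[OF _ u] by blast
  qed
  then have "evol \<alpha> Q B c t s f = u t" using s by (simp add: evol_def)
  then have "\<forall>x. u t x = (LINT y|lebesgue. g t s x y * f y)" using g(2)[OF f(1)] by metis
  with u show ?thesis by blast
qed

section \<open>Extension of kernel operators to \<open>L\<^sup>p\<close>\<close>

text \<open>Measurability in x is required only of the images of nonnegative bounded continuous
  functions, since nothing is known about how the kernel depends on x.\<close>

locale positive_kernel =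
  fixes k :: "'a::euclidean_space \<Rightarrow> 'a \<Rightarrow> real" and p A :: real
  assumes p: "1 < p" and A: "0 \<le> A"
    and k_nonneg: "\<And>x y. 0 \<le> k x y"
    and k_integrable: "\<And>x. integrable lebesgue (k x)"
    and meas_cont: "\<And>f. continuous_on UNIV f \<Longrightarrow> bounded (range f) \<Longrightarrow> (\<And>y. 0 \<le> f y) \<Longrightarrow>
       (\<lambda>x. LINT y|lebesgue. k x y * f y) \<in> borel_measurable lebesgue"
    and bound_cont: "\<And>f. continuous_on UNIV f \<Longrightarrow> bounded (range f) \<Longrightarrow> (\<And>y. 0 \<le> f y) \<Longrightarrow>
       (\<integral>\<^sup>+x. ennreal ((LINT y|lebesgue. k x y * f y) powr p) \<partial>lebesgue)
         \<le> ennreal A * (\<integral>\<^sup>+x. ennreal (f x powr p) \<partial>lebesgue)"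
begin

lemma k_mult_integrable:
  assumes [measurable]: "f \<in> borel_measurable lebesgue" and "\<And>y. \<bar>f y\<bar> \<le> M"
  shows "integrable lebesgue (\<lambda>y. k x y * f y)"
proof (rule Bochner_Integration.integrable_bound)
  show "integrable lebesgue (\<lambda>y. M * k x y)" using k_integrable by simp
  have [measurable]: "k x \<in> borel_measurable lebesgue" using k_integrable by auto
  show "(\<lambda>y. k x y * f y) \<in> borel_measurable lebesgue" by measurable
  have "\<bar>k x y * f y\<bar> \<le> \<bar>M * k x y\<bar>" for y
    using mult_left_mono[OF assms(2)[of y] k_nonneg[of x y]] k_nonneg[of x y]
      order.trans[OF abs_ge_zero assms(2)[of y]] by (simp add: abs_mult mult.commute)
  then show "AE y in lebesgue. norm (k x y * f y) \<le> norm (M * k x y)" by simp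
qed

text \<open>The passage from continuous to measurable functions needs a majorant \<open>h\<close>:
  bounded for convergence of the kernel integrals, p-integrable for convergence of the right-hand
  sides, and continuous so that cutting off at \<open>h\<close> preserves continuity.\<close>

lemma dominated_bound:
  assumes f[measurable]: "f \<in> borel_measurable lebesgue" and fh: "\<And>y. 0 \<le> f y" "\<And>y. f y \<le> h y"
    and h: "continuous_on UNIV h" "\<And>y. h y \<le> M" "(\<integral>\<^sup>+x. ennreal (h x powr p) \<partial>lebesgue) < \<infinity>"
  shows "(\<lambda>x. LINT y|lebesgue. k x y * f y) \<in> borel_measurable lebesgue"
    and "(\<integral>\<^sup>+x. ennreal ((LINT y|lebesgue. k x y * f y) powr p) \<partial>lebesgue)
         \<le> ennreal A * (\<integral>\<^sup>+x. ennreal (f x powr p) \<partial>lebesgue)"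
proof -
  have "f measurable_on UNIV" using lebesgue_measurable_imp_measurable_on[of f UNIV] by simp
  then obtain N G where N: "negligible N" and G: "\<And>n. continuous_on UNIV (G n)"
    and lim: "\<And>x. x \<notin> N \<Longrightarrow> (\<lambda>n. G n x) \<longlonglongrightarrow> f x"
    unfolding measurable_on_def by auto
  define F where "F n x = max 0 (min (G n x) (h x))" for n x
  have F: "continuous_on UNIV (F n)" "\<And>y. 0 \<le> F n y" "\<And>y. F n y \<le> h y" "bounded (range (F n))" for n
  proof -
    show "continuous_on UNIV (F n)" unfolding F_def[abs_def] by (intro continuous_intros G h)
    show le: "0 \<le> F n y" "F n y \<le> h y" for y using fh[of y] by (auto simp: F_def)
    show "bounded (range (F n))"
      using le h(2) order.trans[OF le(2) h(2)] by (intro boundedI[of _ M]) auto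
  qed
  have [measurable]: "F n \<in> borel_measurable lebesgue" "h \<in> borel_measurable lebesgue" for n
    using F(1) h(1) by (auto intro!: measurable_completion borel_measurable_continuous_onI)
  have [measurable]: "k x \<in> borel_measurable lebesgue" for x using k_integrable by auto
  have AE_N: "AE x in lebesgue. x \<notin> N" using N by (simp add: negligible_iff_null_sets AE_not_in)
  have F_lim: "(\<lambda>n. F n x) \<longlonglongrightarrow> f x" if "x \<notin> N" for x
  proof -
    have "(\<lambda>n. F n x) \<longlonglongrightarrow> max 0 (min (f x) (h x))" unfolding F_def by (intro tendsto_intros lim that)
    then show ?thesis using fh[of x] by simp
  qed
  \<comment> \<open>This holds for every x: the exceptional set \<open>N\<close> concerns the
    integration variable y only.\<close>
  have lims: "(\<lambda>n. LINT y|lebesgue. k x y * F n y) \<longlonglongrightarrow> (LINT y|lebesgue. k x y * f y)" for x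
  proof (rule integral_dominated_convergence[where w="\<lambda>y. M * k x y"])
    show "AE y in lebesgue. (\<lambda>n. k x y * F n y) \<longlonglongrightarrow> k x y * f y"
      using AE_N by (rule eventually_mono) (intro tendsto_intros F_lim)
    fix n
    have "\<bar>k x y * F n y\<bar> \<le> M * k x y" for y
      using mult_left_mono[OF order.trans[OF F(3)[of n y] h(2)[of y]] k_nonneg[of x y]] k_nonneg[of x y] F(2)[of n y]
      by (simp add: abs_mult mult.commute)
    then show "AE y in lebesgue. norm (k x y * F n y) \<le> M * k x y" by simp
  qed (use k_integrable in simp_all)
  have meas[measurable]: "(\<lambda>x. LINT y|lebesgue. k x y * F n y) \<in> borel_measurable lebesgue" for n
    by (rule meas_cont[OF F(1,4,2)])
  show "(\<lambda>x. LINT y|lebesgue. k x y * f y) \<in> borel_measurable lebesgue"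
    by (rule borel_measurable_LIMSEQ_metric[OF meas lims])
  have nnF: "0 \<le> (LINT y|lebesgue. k x y * F n y)" for x n
    by (intro integral_nonneg_AE always_eventually allI mult_nonneg_nonneg k_nonneg F(2))
  have "(\<integral>\<^sup>+x. ennreal ((LINT y|lebesgue. k x y * f y) powr p) \<partial>lebesgue)
    = (\<integral>\<^sup>+x. liminf (\<lambda>n. ennreal ((LINT y|lebesgue. k x y * F n y) powr p)) \<partial>lebesgue)"
    using p nnF
    by (intro nn_integral_cong lim_imp_Liminf[symmetric] tendsto_ennrealI tendsto_powr' lims tendsto_const) auto
  also have "\<dots> \<le> liminf (\<lambda>n. \<integral>\<^sup>+x. ennreal ((LINT y|lebesgue. k x y * F n y) powr p) \<partial>lebesgue)"
    by (rule nn_integral_liminf) measurable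
  also have "\<dots> \<le> liminf (\<lambda>n. ennreal A * (\<integral>\<^sup>+x. ennreal (F n x powr p) \<partial>lebesgue))"
    by (intro Liminf_mono always_eventually allI bound_cont F)
  \<comment> \<open>Fatou suffices on the left, but the right-hand side must converge to the
    integral for f itself; this is where the p-integrability of \<open>h\<close> enters.\<close>
  also have "\<dots> = ennreal A * (\<integral>\<^sup>+x. ennreal (f x powr p) \<partial>lebesgue)"
  proof (intro lim_imp_Liminf ennreal_tendsto_cmult nn_integral_dominated_convergence[where w="\<lambda>x. ennreal (h x powr p)"])
    show "AE x in lebesgue. (\<lambda>n. ennreal (F n x powr p)) \<longlonglongrightarrow> ennreal (f x powr p)"
      using AE_N by (rule eventually_mono) (use p F in \<open>auto intro!: tendsto_ennrealI tendsto_powr' F_lim\<close>)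
    fix n show "AE x in lebesgue. ennreal (F n x powr p) \<le> ennreal (h x powr p)"
      using p by (intro always_eventually allI ennreal_leI powr_mono2 F) auto
  qed (use h(3) in auto)
  finally show "(\<integral>\<^sup>+x. ennreal ((LINT y|lebesgue. k x y * f y) powr p) \<partial>lebesgue)
         \<le> ennreal A * (\<integral>\<^sup>+x. ennreal (f x powr p) \<partial>lebesgue)" .
qed

text \<open>Monotone truncation replaces the majorant. The uniform bound for the truncated images
  keeps \<open>v n x\<close> bounded in n for almost every x, and this yields integrability of
  \<open>k x y * f y\<close>; the value of the integral alone would not show it, being 0 for
  nonintegrable functions.\<close>

lemma nonneg_bound:
  assumes f[measurable]: "f \<in> borel_measurable lebesgue" and f0: "\<And>y. 0 \<le> f y"
    and fin: "(\<integral>\<^sup>+x. ennreal (f x powr p) \<partial>lebesgue) < \<infinity>"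
  shows "AE x in lebesgue. integrable lebesgue (\<lambda>y. k x y * f y)"
    and "(\<lambda>x. LINT y|lebesgue. k x y * f y) \<in> borel_measurable lebesgue"
    and "(\<integral>\<^sup>+x. ennreal ((LINT y|lebesgue. k x y * f y) powr p) \<partial>lebesgue)
         \<le> ennreal A * (\<integral>\<^sup>+x. ennreal (f x powr p) \<partial>lebesgue)"
proof -
  \<comment> \<open>A continuous plateau: height n on the ball of radius n, falling linearly to 0 at
    radius n + 1. It is increasing in n and eventually exceeds any given value at each
    point.\<close>
  define h where "h n y = real n * max 0 (min 1 (real n + 1 - norm y))" for n and y :: 'a
  define F where "F n y = min (f y) (h n y)" for n y
  have h: "continuous_on UNIV (h n)" "0 \<le> h n y" "h n y \<le> n" for n y
    unfolding h_def[abs_def] by (auto intro!: continuous_intros mult_left_le)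
  have [measurable]: "h n \<in> borel_measurable lebesgue" for n
    using h(1) by (auto intro!: measurable_completion borel_measurable_continuous_onI)
  have [measurable]: "F n \<in> borel_measurable lebesgue" for n unfolding F_def[abs_def] by measurable
  have [measurable]: "k x \<in> borel_measurable lebesgue" for x using k_integrable by auto
  have F: "0 \<le> F n y" "F n y \<le> h n y" "F n y \<le> f y" for n y using f0 h(2) by (auto simp: F_def)
  have hfin: "(\<integral>\<^sup>+x. ennreal (h n x powr p) \<partial>lebesgue) < \<infinity>" for n
  proof -
    have "(\<integral>\<^sup>+x. ennreal (h n x powr p) \<partial>lebesgue) \<le> (\<integral>\<^sup>+x. ennreal (n powr p) * indicator (cball (0::'a) (real n + 1)) x \<partial>lebesgue)"
    proof (rule nn_integral_mono)
      fix x :: 'a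
      show "ennreal (h n x powr p) \<le> ennreal (n powr p) * indicator (cball 0 (real n + 1)) x"
      proof (cases "norm x \<le> real n + 1")
        case True
        then show ?thesis using h(2,3)[of n x] p by (auto intro!: ennreal_leI powr_mono2)
      next
        case False
        then show ?thesis by (simp add: h_def)
      qed
    qed
    also have "\<dots> = ennreal (n powr p) * emeasure lebesgue (cball 0 (real n + 1) :: 'a set)"
      by (simp add: nn_integral_cmult_indicator)
    also have "\<dots> < \<infinity>"
      using emeasure_lborel_cball_finite[of "0::'a" "real n + 1"] by (simp add: ennreal_mult_less_top)
    finally show ?thesis .
  qed
  define v where "v n x = (LINT y|lebesgue. k x y * F n y)" for n x
  have v_meas[measurable]: "v n \<in> borel_measurable lebesgue"
    and v_bound: "(\<integral>\<^sup>+x. ennreal (v n x powr p) \<partial>lebesgue) \<le> ennreal A * (\<integral>\<^sup>+x. ennreal (F n x powr p) \<partial>lebesgue)" for n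
    unfolding v_def[abs_def] using dominated_bound[of "F n" "h n" n] F h hfin by auto
  let ?S = "ennreal A * (\<integral>\<^sup>+x. ennreal (f x powr p) \<partial>lebesgue)"
  have v_bound': "(\<integral>\<^sup>+x. ennreal (v n x powr p) \<partial>lebesgue) \<le> ?S" for n
    using F p by (intro order.trans[OF v_bound] mult_left_mono nn_integral_mono ennreal_leI powr_mono2) auto
  have F_mono: "F n y \<le> F m y" if "n \<le> m" for n m y
    unfolding F_def h_def using that
    by (intro min.mono order.refl mult_mono max.mono) auto
  have F_int: "integrable lebesgue (\<lambda>y. k x y * F n y)" for n x
    using order.trans[OF F(2) h(3)] F(1) by (intro k_mult_integrable[of _ n]) simp_all
  have v_nonneg: "0 \<le> v n x" for n x
    unfolding v_def by (intro integral_nonneg_AE always_eventually allI mult_nonneg_nonneg k_nonneg F)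
  have v_mono: "v n x \<le> v m x" if "n \<le> m" for n m x
    unfolding v_def by (intro integral_mono F_int mult_left_mono F_mono that k_nonneg)
  have F_lim: "(\<lambda>n. F n y) \<longlonglongrightarrow> f y" for y
  proof (rule tendsto_eventually)
    obtain n0 where n0: "max (norm y) (f y) \<le> real n0" using real_arch_simple by blast
    have "F n y = f y" if "n0 \<le> n" for n
    proof -
      have "norm y \<le> real n" "f y \<le> real n" using that n0 by auto
      then show ?thesis by (simp add: F_def h_def)
    qed
    then show "\<forall>\<^sub>F n in sequentially. F n y = f y" unfolding eventually_sequentially by blast
  qed
  have "(\<integral>\<^sup>+x. (SUP n. ennreal (v n x powr p)) \<partial>lebesgue) = (SUP n. \<integral>\<^sup>+x. ennreal (v n x powr p) \<partial>lebesgue)"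
    using p by (intro nn_integral_monotone_convergence_SUP)
      (auto simp: incseq_def le_fun_def intro!: ennreal_leI powr_mono2 v_nonneg v_mono)
  also have "\<dots> \<le> ?S" by (rule SUP_least) (rule v_bound')
  also have "\<dots> < \<infinity>" using fin by (simp add: ennreal_mult_less_top)
  finally have "(\<integral>\<^sup>+x. (SUP n. ennreal (v n x powr p)) \<partial>lebesgue) \<noteq> \<infinity>" by simp
  then have AE_fin: "AE x in lebesgue. (SUP n. ennreal (v n x powr p)) \<noteq> \<infinity>"
    by (intro nn_integral_noteq_infinite) auto
  have conv: "integrable lebesgue (\<lambda>y. k x y * f y) \<and> (\<lambda>n. v n x) \<longlonglongrightarrow> (LINT y|lebesgue. k x y * f y)"
    if x: "(SUP n. ennreal (v n x powr p)) \<noteq> \<infinity>" for x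
  proof -
    obtain r where r: "0 \<le> r" "(SUP n. ennreal (v n x powr p)) = ennreal r" using x by (cases "SUP n. ennreal (v n x powr p)") auto
    have "v n x \<le> r powr (1 / p)" for n
    proof -
      have "ennreal (v n x powr p) \<le> ennreal r" unfolding r(2)[symmetric] by (rule SUP_upper) simp
      then have "v n x powr p \<le> r" using r(1) by simp
      then have "(v n x powr p) powr (1 / p) \<le> r powr (1 / p)" using p by (intro powr_mono2) auto
      then show ?thesis using p v_nonneg by (simp add: powr_powr)
    qed
    then have "bdd_above (range (\<lambda>n. v n x))" by (intro bdd_aboveI2)
    then have lim: "(\<lambda>n. v n x) \<longlonglongrightarrow> (SUP n. v n x)"
      by (intro LIMSEQ_incseq_SUP) (auto simp: incseq_def v_mono)
    have "AE y in lebesgue. mono (\<lambda>n. k x y * F n y)" "AE y in lebesgue. (\<lambda>n. k x y * F n y) \<longlonglongrightarrow> k x y * f y"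
      by (intro always_eventually allI monoI mult_left_mono F_mono k_nonneg tendsto_intros F_lim; assumption)+
    note ** = integrable_monotone_convergence[OF F_int[of x] this lim[unfolded v_def]]
      integral_monotone_convergence[OF F_int[of x] this lim[unfolded v_def]]
    then have "integrable lebesgue (\<lambda>y. k x y * f y)" "(LINT y|lebesgue. k x y * f y) = (SUP n. v n x)"
      by (auto simp: v_def)
    with lim show ?thesis by simp
  qed
  show "AE x in lebesgue. integrable lebesgue (\<lambda>y. k x y * f y)"
    using AE_fin by (rule eventually_mono) (use conv in blast)
  have AE_lim: "AE x in lebesgue. (\<lambda>n. v n x) \<longlonglongrightarrow> (LINT y|lebesgue. k x y * f y)"
    using AE_fin by (rule eventually_mono) (use conv in blast)
  \<comment> \<open>Convergence is known only almost everywhere. The total function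
    \<open>lim\<close> is measurable, and completeness of Lebesgue measure transfers this to the
    integral.\<close>
  have "(\<lambda>x. lim (\<lambda>n. v n x)) \<in> borel_measurable lebesgue"
    by (rule borel_measurable_lim_metric) (rule v_meas)
  moreover have "AE x in lebesgue. lim (\<lambda>n. v n x) = (LINT y|lebesgue. k x y * f y)"
    using AE_lim by (rule eventually_mono) (rule limI)
  ultimately show "(\<lambda>x. LINT y|lebesgue. k x y * f y) \<in> borel_measurable lebesgue"
    by (rule borel_measurable_AE)
  have "(\<integral>\<^sup>+x. ennreal ((LINT y|lebesgue. k x y * f y) powr p) \<partial>lebesgue)
    = (\<integral>\<^sup>+x. liminf (\<lambda>n. ennreal (v n x powr p)) \<partial>lebesgue)"
  proof (rule nn_integral_cong_AE, rule eventually_mono[OF AE_lim])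
    fix x assume "(\<lambda>n. v n x) \<longlonglongrightarrow> (LINT y|lebesgue. k x y * f y)"
    then have "(\<lambda>n. ennreal (v n x powr p)) \<longlonglongrightarrow> ennreal ((LINT y|lebesgue. k x y * f y) powr p)"
      using p v_nonneg by (intro tendsto_ennrealI tendsto_powr' tendsto_const) auto
    then show "ennreal ((LINT y|lebesgue. k x y * f y) powr p) = liminf (\<lambda>n. ennreal (v n x powr p))"
      by (intro lim_imp_Liminf[symmetric]) simp_all
  qed
  also have "\<dots> \<le> liminf (\<lambda>n. \<integral>\<^sup>+x. ennreal (v n x powr p) \<partial>lebesgue)"
    by (rule nn_integral_liminf) measurable
  also have "\<dots> \<le> liminf (\<lambda>n. ?S)"
    by (intro Liminf_mono always_eventually allI v_bound')
  finally show "(\<integral>\<^sup>+x. ennreal ((LINT y|lebesgue. k x y * f y) powr p) \<partial>lebesgue) \<le> ?S"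
    by (simp add: Liminf_const)
qed

text \<open>Positive and negative parts give integrability and measurability. The norm bound is
  taken from |f| instead, because adding the bounds of the two parts would spoil the constant
  \<open>A\<close>.\<close>

lemma Lp_bound:
  assumes f[measurable]: "f \<in> borel_measurable lebesgue"
    and fin: "(\<integral>\<^sup>+x. ennreal (\<bar>f x\<bar> powr p) \<partial>lebesgue) < \<infinity>"
  shows "AE x in lebesgue. integrable lebesgue (\<lambda>y. k x y * f y)"
    and "(\<lambda>x. LINT y|lebesgue. k x y * f y) \<in> borel_measurable lebesgue"
    and "(\<integral>\<^sup>+x. ennreal (\<bar>LINT y|lebesgue. k x y * f y\<bar> powr p) \<partial>lebesgue)
         \<le> ennreal A * (\<integral>\<^sup>+x. ennreal (\<bar>f x\<bar> powr p) \<partial>lebesgue)"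
proof -
  have part: "(\<lambda>y. max 0 (\<sigma> * f y)) \<in> borel_measurable lebesgue" "\<And>y. 0 \<le> max 0 (\<sigma> * f y)"
      "(\<integral>\<^sup>+x. ennreal (max 0 (\<sigma> * f x) powr p) \<partial>lebesgue) < \<infinity>" if "\<sigma> \<in> {1, -1}" for \<sigma> :: real
  proof -
    have "(\<integral>\<^sup>+x. ennreal (max 0 (\<sigma> * f x) powr p) \<partial>lebesgue) \<le> (\<integral>\<^sup>+x. ennreal (\<bar>f x\<bar> powr p) \<partial>lebesgue)"
      using p that by (intro nn_integral_mono ennreal_leI powr_mono2) auto
    with fin show "(\<integral>\<^sup>+x. ennreal (max 0 (\<sigma> * f x) powr p) \<partial>lebesgue) < \<infinity>" by (rule le_less_trans[rotated])
  qed auto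
  note pos = nonneg_bound[OF part[of 1], simplified]
  note neg = nonneg_bound[OF part[of "-1"], simplified]
  have abs: "(\<lambda>y. \<bar>f y\<bar>) \<in> borel_measurable lebesgue" "\<And>y. 0 \<le> \<bar>f y\<bar>" by auto
  note abs_bound = nonneg_bound[OF abs fin]
  have split: "k x y * f y = k x y * max 0 (f y) - k x y * max 0 (- f y)" for x y
    by (simp add: right_diff_distrib[symmetric] max_def)
  show int: "AE x in lebesgue. integrable lebesgue (\<lambda>y. k x y * f y)"
    using pos(1) neg(1) by eventually_elim (simp add: split)
  have "AE x in lebesgue. (LINT y|lebesgue. k x y * max 0 (f y)) - (LINT y|lebesgue. k x y * max 0 (- f y))
      = (LINT y|lebesgue. k x y * f y)"
    using pos(1) neg(1) by eventually_elim (simp add: split)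
  moreover have "(\<lambda>x. (LINT y|lebesgue. k x y * max 0 (f y)) - (LINT y|lebesgue. k x y * max 0 (- f y))) \<in> borel_measurable lebesgue"
    using pos(2) neg(2) by (rule borel_measurable_diff)
  ultimately show "(\<lambda>x. LINT y|lebesgue. k x y * f y) \<in> borel_measurable lebesgue"
    by (rule borel_measurable_AE[rotated])
  have "(\<integral>\<^sup>+x. ennreal (\<bar>LINT y|lebesgue. k x y * f y\<bar> powr p) \<partial>lebesgue)
      \<le> (\<integral>\<^sup>+x. ennreal ((LINT y|lebesgue. k x y * \<bar>f y\<bar>) powr p) \<partial>lebesgue)"
  proof (rule nn_integral_mono_AE, rule always_eventually, intro allI ennreal_leI powr_mono2)
    fix x
    have "\<bar>LINT y|lebesgue. k x y * f y\<bar> \<le> (LINT y|lebesgue. norm (k x y * f y))"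
      using integral_norm_bound[of lebesgue "\<lambda>y. k x y * f y"] by simp
    also have "\<dots> = (LINT y|lebesgue. k x y * \<bar>f y\<bar>)" by (simp add: abs_mult k_nonneg)
    finally show "\<bar>LINT y|lebesgue. k x y * f y\<bar> \<le> (LINT y|lebesgue. k x y * \<bar>f y\<bar>)" .
  qed (use p in auto)
  also note abs_bound(3)
  finally show "(\<integral>\<^sup>+x. ennreal (\<bar>LINT y|lebesgue. k x y * f y\<bar> powr p) \<partial>lebesgue)
         \<le> ennreal A * (\<integral>\<^sup>+x. ennreal (\<bar>f x\<bar> powr p) \<partial>lebesgue)" .
qed

end

section \<open>The estimate for the evolution operator\<close>

theorem theorem5p4:
  fixes \<alpha> p a b K :: real and I :: "real set"
    and Q :: "real \<Rightarrow> real^'d \<Rightarrow> 'd \<Rightarrow> 'd \<Rightarrow> real"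
    and B :: "real \<Rightarrow> real^'d \<Rightarrow> 'd \<Rightarrow> real"
    and c \<eta> :: "real \<Rightarrow> real^'d \<Rightarrow> real"
    and g :: "real \<Rightarrow> real \<Rightarrow> real^'d \<Rightarrow> real^'d \<Rightarrow> real"
    and DQ :: "'d \<Rightarrow> 'd \<Rightarrow> 'd \<Rightarrow> real \<Rightarrow> real^'d \<Rightarrow> real"
    and f :: "real^'d \<Rightarrow> real"
  assumes std: "standing_assms \<alpha> I Q B c \<eta>"
    and green: "green_fun \<alpha> I Q B c g"
    and p: "1 < p"
    and ab: "a \<in> I" "b \<in> I" "a < b"
    and DQ_deriv: "\<forall>t\<in>{a..b}. \<forall>x i j k. has_partial (\<lambda>y. Q t y i j) k x (DQ k i j t x)"
    and DQ_cont: "\<forall>i j k. continuous_on ({a..b} \<times> UNIV) (\<lambda>(t, x). DQ k i j t x)"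
    and K: "0 < K"
    and Kbound: "\<forall>t\<in>{a..b}. \<forall>x.
        (\<Sum>i\<in>UNIV. (B t x i - (\<Sum>j\<in>UNIV. DQ j i j t x))\<^sup>2) / (4 * (p - 1) * \<eta> t x) - c t x \<le> K"
    and st: "a \<le> s" "s \<le> t" "t \<le> b"
    and f: "in_Lp p f"
  shows "(s < t \<longrightarrow> (AE x in lebesgue. integrable lebesgue (\<lambda>y. g t s x y * f y)))
    \<and> in_Lp p (green_apply g t s f)
    \<and> Lp_norm p (green_apply g t s f) \<le> exp (K * (t - s)) * Lp_norm p f"
proof (cases "s = t")
  case True
  then have "green_apply g t s f = f" by (simp add: green_apply_def fun_eq_iff)
  with True f show ?thesis by simp
next
  case False
  with st have lt: "s < t" by simp
  have \<alpha>: "0 < \<alpha>" using std by (simp add: standing_assms_def)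
  have ab_I: "{a..b} \<subseteq> I" using std ab unfolding standing_assms_def by auto
  then have sI: "s \<in> I" using st by auto
  have sub: "\<tau> \<in> {a..b}" "\<tau> \<in> I" if "\<tau> \<in> {s<..<t}" for \<tau> using that st ab_I by auto
  have Q_holder: "holder_loc \<alpha> (I \<times> UNIV) (\<lambda>t x. Q t x i j)" for i j using std by (simp add: standing_assms_def)
  have Q_sym: "Q \<tau> x i j = Q \<tau> x j i" if "\<tau> \<in> I" for \<tau> x i j using std that by (simp add: standing_assms_def)
  have ell: "\<eta> \<tau> x * (norm \<xi>)\<^sup>2 \<le> (\<Sum>i\<in>UNIV. \<Sum>j\<in>UNIV. Q \<tau> x i j * \<xi>$i * \<xi>$j)" if "\<tau> \<in> I" for \<tau> x \<xi>
    using std that by (simp add: standing_assms_def)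
  have "\<exists>\<eta>0>0. \<forall>t\<in>I. \<forall>x. \<eta>0 \<le> \<eta> t x" using std by (simp add: standing_assms_def)
  then have \<eta>: "0 < \<eta> \<tau> x" if "\<tau> \<in> I" for \<tau> x using that by (meson less_le_trans)
  have "is_interval {a..b} \<and> bounded {a..b} \<and> {a..b} \<subseteq> I" using ab_I by (simp add: is_interval_cc)
  then obtain \<phi> D\<phi> D2\<phi> lam0 where \<phi>: "C2_with \<phi> D\<phi> D2\<phi>" "\<forall>x. 0 < \<phi> x" "filterlim \<phi> at_top at_infinity"
    and lam0: "\<forall>t\<in>{a..b}. \<forall>x. Aop Q B c t x (\<phi> x) (\<lambda>i. D\<phi> i x) (\<lambda>i j. D2\<phi> i j x) \<le> lam0 * \<phi> x"
    using std unfolding standing_assms_def by meson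
  \<comment> \<open>Raising the rate to be nonnegative is harmless because \<phi> is
    positive.\<close>
  define lam where "lam = max 0 lam0"
  have lyap: "Aop Q B c \<tau> x (\<phi> x) (\<lambda>i. D\<phi> i x) (\<lambda>i j. D2\<phi> i j x) \<le> lam * \<phi> x" if "\<tau> \<in> {s<..<t}" for \<tau> x
  proof -
    have "Aop Q B c \<tau> x (\<phi> x) (\<lambda>i. D\<phi> i x) (\<lambda>i j. D2\<phi> i j x) \<le> lam0 * \<phi> x" using lam0 sub(1)[OF that] by blast
    also have "\<dots> \<le> lam * \<phi> x" using \<phi>(2) by (intro mult_right_mono) (auto simp: lam_def less_imp_le)
    finally show ?thesis .
  qed
  have lam: "0 \<le> lam" by (simp add: lam_def)
  interpret D: dissipative_coefficients p K s t Q B c \<eta> DQ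
  proof
    fix \<tau> x assume \<tau>: "\<tau> \<in> {s<..<t}"
    show "Q \<tau> x i j = Q \<tau> x j i" for i j by (rule Q_sym[OF sub(2)[OF \<tau>]])
    show "continuous_on UNIV (\<lambda>x. Q \<tau> x i j)" for i j
      by (rule holder_loc_continuous_on_slice[OF Q_holder \<alpha> sub(2)[OF \<tau>]])
    show "has_partial (\<lambda>y. Q \<tau> y i j) k x (DQ k i j \<tau> x)" for i j k using DQ_deriv sub(1)[OF \<tau>] by blast
    show "continuous_on UNIV (DQ k i j \<tau>)" for i j k
      by (rule continuous_on_slice[OF _ sub(1)[OF \<tau>]]) (use DQ_cont in blast)
    show "0 < \<eta> \<tau> x" by (rule \<eta>[OF sub(2)[OF \<tau>]])
    show "\<eta> \<tau> x * (norm \<xi>)\<^sup>2 \<le> (\<Sum>i\<in>UNIV. \<Sum>j\<in>UNIV. Q \<tau> x i j * \<xi>$i * \<xi>$j)" for \<xi> by (rule ell[OF sub(2)[OF \<tau>]])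
    show "(\<Sum>i\<in>UNIV. (B \<tau> x i - (\<Sum>j\<in>UNIV. DQ j i j \<tau> x))\<^sup>2) / (4 * (p - 1) * \<eta> \<tau> x) - c \<tau> x \<le> K"
      using Kbound sub(1)[OF \<tau>] by blast
  qed (use p K lt in auto)
  have uniq: "u t = v t" if "cauchy_sol \<alpha> Q B c s f u" "cauchy_sol \<alpha> Q B c s f v" for f u v
  proof (rule D.bounded_sol_unique[OF _ _ _ \<phi>(1) \<phi>(2)[rule_format] \<phi>(3) lyap lam])
    show "bounded_sol Q B c s t u" "bounded_sol Q B c s t v"
      by (rule cauchy_sol_imp_bounded_sol[OF _ \<alpha> lt], rule that)+
    show "u s = v s" using that by (auto simp: cauchy_sol_def fun_eq_iff)
  qed
  have g_pos: "0 < g t s x y" for x y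
    using green sI lt unfolding green_fun_def by blast
  have g_int: "integrable lebesgue (\<lambda>y. g t s x y * h y)" if "h \<in> Cb" for h x
    using green sI lt that unfolding green_fun_def by auto
  \<comment> \<open>The constant is that for p-th powers; its p-th root
    \<open>exp (K * (t - s))\<close> appears at the end.\<close>
  interpret k: positive_kernel "g t s" p "exp (p * K * (t - s))"
  proof
    show "0 \<le> g t s x y" for x y using g_pos[of x y] by simp
    \<comment> \<open>Testing the Green function with the constant 1 shows that each
      \<open>g t s x\<close> is integrable.\<close>
    have "(\<lambda>_. 1) \<in> Cb" by (simp add: Cb_def)
    then show "integrable lebesgue (g t s x)" for x using g_int[of "\<lambda>_. 1" x] by simp
    fix h :: "real^'d \<Rightarrow> real" assume h: "continuous_on UNIV h" "bounded (range h)" "\<And>y. 0 \<le> h y"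
    have "(\<lambda>x. LINT y|lebesgue. g t s x y * h y) \<in> borel_measurable lebesgue \<and>
      (\<integral>\<^sup>+x. ennreal ((LINT y|lebesgue. g t s x y * h y) powr p) \<partial>lebesgue)
         \<le> ennreal (exp (p * K * (t - s))) * (\<integral>\<^sup>+x. ennreal (h x powr p) \<partial>lebesgue)"
    \<comment> \<open>The zero datum is separated: the argument for solvability compares the
      integrals for h and 2 h, which coincide when h = 0, but then both claims are trivial.\<close>
    proof (cases "\<exists>y. h y \<noteq> 0")
      case True
      then obtain y0 where y0: "h y0 \<noteq> 0" by blast
      have Cb: "h \<in> Cb" using h by (simp add: Cb_def)
      have "\<exists>u. cauchy_sol \<alpha> Q B c s h u \<and> (\<forall>x. u t x = (LINT y|lebesgue. g t s x y * h y))"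
        by (rule cauchy_sol_exists_green[OF green sI lt _ Cb _ y0]) (erule (1) uniq, rule h(3))
      then obtain u where u: "cauchy_sol \<alpha> Q B c s h u" "\<And>x. u t x = (LINT y|lebesgue. g t s x y * h y)"
        by blast
      have us: "u s x = h x" for x using u(1) by (simp add: cauchy_sol_def)
      have sol: "bounded_sol Q B c s t u" by (rule cauchy_sol_imp_bounded_sol[OF u(1) \<alpha> lt])
      have "continuous_on UNIV (u t)"
        using sol lt continuous_on_slice[of "{s..t}" UNIV u t] unfolding bounded_sol_def by auto
      then have "u t \<in> borel_measurable lebesgue"
        by (auto intro!: measurable_completion borel_measurable_continuous_onI)
      \<comment> \<open>Nonnegativity of the solution is read off from the kernel, so that its
        positive part is the solution itself.\<close>
      moreover have "0 \<le> u t x" for x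
        unfolding u(2)
        by (intro integral_nonneg_AE always_eventually allI mult_nonneg_nonneg h(3) less_imp_le[OF g_pos])
      then have "(\<integral>\<^sup>+x. ennreal (u t x powr p) \<partial>lebesgue)
         \<le> ennreal (exp (p * K * (t - s))) * (\<integral>\<^sup>+x. ennreal (h x powr p) \<partial>lebesgue)"
        using D.sol_energy[OF sol \<phi>(1) \<phi>(2)[rule_format] \<phi>(3) lyap lam] h(3)
        by (simp add: us nn_integral_completion max_absorb2)
      ultimately show ?thesis unfolding u(2)[abs_def] u(2) by blast
    next
      case False
      then show ?thesis by simp
    qed
    then show "(\<lambda>x. LINT y|lebesgue. g t s x y * h y) \<in> borel_measurable lebesgue"
      "(\<integral>\<^sup>+x. ennreal ((LINT y|lebesgue. g t s x y * h y) powr p) \<partial>lebesgue)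
         \<le> ennreal (exp (p * K * (t - s))) * (\<integral>\<^sup>+x. ennreal (h x powr p) \<partial>lebesgue)" by auto
  qed (use p in auto)
  have f_meas: "f \<in> borel_measurable lebesgue" and f_int: "integrable lebesgue (\<lambda>x. \<bar>f x\<bar> powr p)"
    using f by (auto simp: in_Lp_def)
  have f_nn: "(\<integral>\<^sup>+x. ennreal (\<bar>f x\<bar> powr p) \<partial>lebesgue) = ennreal (LINT x|lebesgue. \<bar>f x\<bar> powr p)"
    using f_int by (rule nn_integral_eq_integral) simp
  then have fin: "(\<integral>\<^sup>+x. ennreal (\<bar>f x\<bar> powr p) \<partial>lebesgue) < \<infinity>" by simp
  define v where "v = green_apply g t s f"
  have v: "v = (\<lambda>x. LINT y|lebesgue. g t s x y * f y)"
    using lt by (simp add: v_def green_apply_def fun_eq_iff)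
  note bound = k.Lp_bound[OF f_meas fin]
  have v_meas: "v \<in> borel_measurable lebesgue" unfolding v by (rule bound)
  have v_bound: "(\<integral>\<^sup>+x. ennreal (\<bar>v x\<bar> powr p) \<partial>lebesgue) \<le> ennreal (exp (p * K * (t - s)) * (LINT x|lebesgue. \<bar>f x\<bar> powr p))"
    using bound(3) unfolding v f_nn by (simp add: ennreal_mult')
  have v_int: "integrable lebesgue (\<lambda>x. \<bar>v x\<bar> powr p)"
    using v_meas v_bound by (intro integrableI_bounded) (auto intro: le_less_trans)
  have "(\<integral>\<^sup>+x. ennreal (\<bar>v x\<bar> powr p) \<partial>lebesgue) = ennreal (LINT x|lebesgue. \<bar>v x\<bar> powr p)"
    using v_int by (rule nn_integral_eq_integral) simp
  with v_bound have "(LINT x|lebesgue. \<bar>v x\<bar> powr p) \<le> exp (p * K * (t - s)) * (LINT x|lebesgue. \<bar>f x\<bar> powr p)"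
    by (simp add: ennreal_le_iff)
  then have "Lp_norm p v \<le> (exp (p * K * (t - s)) * (LINT x|lebesgue. \<bar>f x\<bar> powr p)) powr (1 / p)"
    unfolding Lp_norm_def using p by (intro powr_mono2) auto
  also have "\<dots> = exp (K * (t - s)) * Lp_norm p f"
    unfolding Lp_norm_def using p by (simp add: powr_mult powr_def[of "exp _"])
  finally have "Lp_norm p v \<le> exp (K * (t - s)) * Lp_norm p f" .
  then show ?thesis
    using bound(1) v_meas v_int unfolding v_def[symmetric] in_Lp_def by blast
qed

end
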